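(* Let $\Omega=[0,1)$ with Lebesgue measure $\mathbb P$, let $p(\cdot):[0,1)\to(0,\infty)$ be measurable with $1<p_-\le p_+<\infty$, where $p_-=\operatorname{ess\,inf}p$, $p_+=\operatorname{ess\,sup}p$, and let $0<s<\infty$. Assume that there is a constant $K\ge1$ such that $\mathbb P(A)^{p_-(A)-p_+(A)}\le K$ for every dyadic interval $A\subset[0,1)$. If $$\frac1{p_-}-\frac1{p_+}<s,$$ then there is a constant $C$ (independent of $f$) such that $$\|U_sf\|_{p(\cdot)}\le C\|f\|_{p(\cdot)}\qquad\text{for all } f\in L_{p(\cdot)}.$$
   Context: For measurable $A\subset[0,1)$, $p_-(A)=\operatorname{ess\,inf}_{x\in A}p(x)$ and $p_+(A)=\operatorname{ess\,sup}_{x\in A}p(x)$. $\|f\|_{p(\cdot)}=\inf\{\lambda>0:\int_0^1(|f(x)|/\lambda)^{p(x)}dx\le1\}$, and $L_{p(\cdot)}$ is the set of measurable functions on $[0,1)$ with $\|f\|_{p(\cdot)}<\infty$ (contained in $L_1$ here). Dyadic intervals are $[k2^{-n},(k+1)2^{-n})$, $n\in\mathbb N=\{0,1,2,\dots\}$, $0\le k<2^n$. $\dot+$ denotes dyadic addition on $[0,1)$: binary digits are added modulo 2 without carry (using the finite binary expansion for dyadic rationals). For a dyadic interval $I$ of length $2^{-n}$ and $0\le j<n$, $I\dot+2^{-j-1}=\{x\dot+2^{-j-1}:x\in I\}$, again a dyadic interval of length $2^{-n}$. For $f\in L_1[0,1)$, $$U_sf(x)=\sup_{I\ni x}\ \sum_{j=0}^{n-1}2^{(j-n)s}\frac1{\mathbb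 P(I\dot+2^{-j-1})}\left|\int_{I\dot+2^{-j-1}}f\,d\mathbb P\right|,$$ where the supremum is over all dyadic intervals $I$ containing $x$ and $2^{-n}$ is the length of $I$. *)

theory Defs
  imports "HOL-Analysis.Analysis" "HOL-Probability.Essential_Supremum"
begin

abbreviation unit_leb :: "real measure" where
  "unit_leb \<equiv> lebesgue_on {0..<1}"

definition dyadic_interval :: "nat \<Rightarrow> nat \<Rightarrow> real set" where
  "dyadic_interval n k = {real k / 2 ^ n ..< (real k + 1) / 2 ^ n}"


subsection \<open>Variable exponent Lebesgue spaces\<close>

text \<open>
  The essential bounds are extended reals, so that \<open>1 < p_minus\<close> and \<open>p_plus < \<infinity>\<close> are genuine
  conditions.
\<close>

definition essinf :: "'a measure \<Rightarrow> ('a \<Rightarrow> ereal) \<Rightarrow> ereal" where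
  "essinf M f = Sup {z. AE x in M. z \<le> f x}"

definition p_minus :: "(real \<Rightarrow> real) \<Rightarrow> real set \<Rightarrow> ereal" where
  "p_minus p A = essinf (lebesgue_on A) (\<lambda>x. ereal (p x))"

definition p_plus :: "(real \<Rightarrow> real) \<Rightarrow> real set \<Rightarrow> ereal" where
  "p_plus p A = esssup (lebesgue_on A) (\<lambda>x. ereal (p x))"

text \<open>Meant for positive exponents \<open>a\<close>, where \<open>\<infinity>\<close> to the power \<open>a\<close> is \<open>\<infinity>\<close>.\<close>

definition ennreal_powr :: "ennreal \<Rightarrow> real \<Rightarrow> ennreal" where
  "ennreal_powr x a = (if x = \<infinity> then \<infinity> else ennreal (enn2real x powr a))"

text \<open>
  The Luxemburg norm takes functions with values in \<open>[0, \<infinity>]\<close>, since a maximal function can be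
  infinite; a real function \<open>f\<close> enters through its absolute value. The infimum of the empty set
  is \<open>\<infinity>\<close>.
\<close>

definition Lvar_norm :: "(real \<Rightarrow> real) \<Rightarrow> (real \<Rightarrow> ennreal) \<Rightarrow> ennreal" where
  "Lvar_norm p g =
     (INF l \<in> {l::real. 0 < l \<and> (\<integral>\<^sup>+ x. ennreal_powr (g x / ennreal l) (p x) \<partial>unit_leb) \<le> 1}.
        ennreal l)"

definition Lvar :: "(real \<Rightarrow> real) \<Rightarrow> (real \<Rightarrow> real) set" where
  "Lvar p = {f \<in> borel_measurable unit_leb. Lvar_norm p (\<lambda>x. ennreal \<bar>f x\<bar>) < \<infinity>}"


subsection \<open>Dyadic addition and the maximal operator\<close>

text \<open>
  For \<open>x \<in> [0,1)\<close>, \<open>bin_digit x k\<close> is the digit of weight \<open>1 / 2 ^ (k + 1)\<close>; the floor selects the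
  finite expansion of a dyadic rational.
\<close>

definition bin_digit :: "real \<Rightarrow> nat \<Rightarrow> int" where
  "bin_digit x k = \<lfloor>2 ^ (k + 1) * x\<rfloor> mod 2"

definition dyadic_add :: "real \<Rightarrow> real \<Rightarrow> real" where
  "dyadic_add x y = (\<Sum>k. of_int ((bin_digit x k + bin_digit y k) mod 2) / 2 ^ (k + 1))"

definition dyadic_shift :: "real set \<Rightarrow> nat \<Rightarrow> real set" where
  "dyadic_shift I j = (\<lambda>x. dyadic_add x (1 / 2 ^ (j + 1))) ` I"

definition U_max :: "real \<Rightarrow> (real \<Rightarrow> real) \<Rightarrow> real \<Rightarrow> ennreal" where
  "U_max s f x =
     (SUP (n, k) \<in> {(n, k). k < 2 ^ n \<and> x \<in> dyadic_interval n k}.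
        ennreal (\<Sum>j<n. 2 powr ((real j - real n) * s)
          * (1 / measure unit_leb (dyadic_shift (dyadic_interval n k) j))
          * \<bar>LINT y:dyadic_shift (dyadic_interval n k) j|unit_leb. f y\<bar>))"

end

theory Submission
  imports Defs
begin

text \<open>
  By homogeneity it is enough to bound the modular of \<open>U_max s f\<close> when
  \<open>\<integral> \<bar>f\<bar> powr p \<le> 1\<close>. Let \<open>P\<close> and \<open>Q\<close> be the essential bounds of \<open>p\<close>,
  \<open>d = s - (1 / P - 1 / Q) > 0\<close>, let \<open>u\<close> be the part of \<open>\<bar>f\<bar>\<close> that exceeds \<open>1\<close> and
  \<open>g = u powr (p / P)\<close>, so that \<open>\<integral> g powr P \<le> 1\<close>. The rest of \<open>\<bar>f\<bar>\<close> contributes only a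
  geometric series.

  Fix \<open>x\<close> in a dyadic interval \<open>I\<close> of level \<open>n\<close>, and \<open>j < n\<close>, and put \<open>m = n - j\<close>. Both \<open>I\<close> and its
  shift \<open>J\<close> by \<open>1 / 2 ^ (j + 1)\<close> lie in the level \<open>j\<close> interval \<open>A\<close> around \<open>x\<close>. With
  \<open>q\<close> the essential infimum of \<open>p\<close> on \<open>A\<close>, Jensen's inequality bounds the average of \<open>u\<close> over \<open>J\<close>
  by \<open>b powr (P / q)\<close>, where \<open>b\<close> is the average of \<open>g\<close> over \<open>J\<close>. Replacing the exponent \<open>P / q\<close>
  by \<open>P / p x\<close> costs a power of \<open>b \<le> 2 powr (n / P)\<close>. Of this power, the factor coming from the
  first \<open>j\<close> levels is bounded by the regularity hypothesis on \<open>A\<close>, and the factor coming from the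
  other \<open>m\<close> levels is at most \<open>2 powr (m * (1 / P - 1 / Q))\<close>, which the weight
  \<open>2 powr (- m * s)\<close> absorbs, leaving \<open>2 powr (- m * d)\<close> (lemma \<open>exponent_gain\<close>). Half of this gain
  makes the sum over \<open>j\<close> converge; the other half is put into the maximal function
  \<open>W = flip_max (d / 2) g\<close>, the supremum of \<open>2 powr (- m * d / 2) * b\<close> over all \<open>I\<close> and \<open>j\<close>. The result is the
  pointwise bound of \<open>U_max s f x\<close> by a constant times \<open>(max 1 (W x)) powr (P / p x)\<close>
  (lemma \<open>U_max_le_flip_max\<close>).

  The problem is thereby reduced to the boundedness of \<open>flip_max\<close> at the constant exponent \<open>P > 1\<close>
  (lemma \<open>flip_max_strong_type\<close>). For one fixed \<open>m\<close>, stop at the first level at which an average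
  of \<open>h\<close> exceeds \<open>l\<close>. An interval whose shift lies in a stopped interval \<open>F\<close> is contained in \<open>F\<close> or in
  one of \<open>m\<close> shifts of \<open>F\<close>, according to whether the flipped digit comes after the level of \<open>F\<close> or
  not. This gives a weak type \<open>(1,1)\<close> estimate with constant \<open>m + 1\<close>
  (lemma \<open>flipped_avg_weak_type\<close>), which is summable against \<open>2 powr (- m * d / 2)\<close>; truncation of
  \<open>g\<close> and summation over the levels \<open>2 ^ k\<close> turn it into the strong type estimate.
\<close>

section \<open>Dyadic intervals and digit flips\<close>

text \<open>
  The index of the level \<open>n\<close> dyadic interval that contains \<open>x\<close>. In this encoding passing from
  level \<open>n\<close> to the coarser level \<open>n - r\<close> is \<open>drop_bit r\<close>, and changing the binary digit of weight
  \<open>1 / 2 ^ (j + 1)\<close> is \<open>flip_bit (n - 1 - j)\<close>, because the bits of an index are numbered from the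
  least significant one.
\<close>

definition dyadic_index :: "nat \<Rightarrow> real \<Rightarrow> nat" where
  "dyadic_index n x = nat \<lfloor>2 ^ n * x\<rfloor>"

lemma dyadic_index_unique:
  assumes "0 \<le> x"
  shows "x \<in> dyadic_interval n k \<longleftrightarrow> dyadic_index n x = k"
proof -
  have "x \<in> dyadic_interval n k \<longleftrightarrow> real k \<le> 2 ^ n * x \<and> 2 ^ n * x < real k + 1"
    by (auto simp: dyadic_interval_def field_simps)
  also have "\<dots> \<longleftrightarrow> \<lfloor>2 ^ n * x\<rfloor> = int k"
    by (auto simp: floor_eq_iff)
  also have "\<dots> \<longleftrightarrow> dyadic_index n x = k"
    using assms by (auto simp: dyadic_index_def nat_eq_iff)
  finally show ?thesis .
qed

lemma dyadic_index_less:
  assumes "x \<in> {0..<1}"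
  shows "dyadic_index n x < 2 ^ n"
proof -
  have "\<lfloor>2 ^ n * x\<rfloor> < 2 ^ n"
    using assms by (simp add: floor_less_iff)
  then show ?thesis
    by (simp add: dyadic_index_def nat_less_iff)
qed

lemma dyadic_interval_subset_unit:
  assumes "k < 2 ^ n"
  shows "dyadic_interval n k \<subseteq> {0..<1}"
proof -
  have "real (k + 1) \<le> real (2 ^ n)"
    using assms by (subst of_nat_le_iff) simp
  then have "(real k + 1) / 2 ^ n \<le> 1"
    by simp
  moreover have "0 \<le> real k / 2 ^ n"
    by simp
  ultimately show ?thesis
    unfolding dyadic_interval_def by (meson atLeastLessThan_subset_iff ivl_subset)
qed

lemma drop_bit_dyadic_index:
  assumes "r \<le> n" "0 \<le> x"
  shows "drop_bit r (dyadic_index n x) = dyadic_index (n - r) x"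
proof -
  have "\<lfloor>2 ^ n * x / real_of_int (2 ^ r)\<rfloor> = \<lfloor>2 ^ n * x\<rfloor> div 2 ^ r"
    by (rule floor_divide_real_eq_div) simp
  moreover have "2 ^ n * x / real_of_int (2 ^ r) = 2 ^ (n - r) * x"
    using assms by (simp add: power_diff)
  ultimately show ?thesis
    using assms(2) by (simp add: dyadic_index_def drop_bit_eq_div nat_div_distrib nat_power_eq)
qed

text \<open>
  Seen from a coarser level, a flipped digit is either still a flipped digit or has been forgotten.
  This dichotomy is what the weak type estimate below rests on.
\<close>

lemma drop_bit_flip_bit_nat:
  fixes k :: nat
  shows "drop_bit r (flip_bit b k) =
    (if r \<le> b then flip_bit (b - r) (drop_bit r k) else drop_bit r k)"
  by (rule bit_eqI) (auto simp: bit_simps)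

lemma flip_bit_involution: "flip_bit b (flip_bit b k) = (k :: nat)"
  by (rule bit_eqI) (auto simp: bit_simps)

lemma flip_bit_less:
  fixes k :: nat
  assumes "k < 2 ^ n" "b < n"
  shows "flip_bit b k < 2 ^ n"
proof -
  have "take_bit n (flip_bit b k) = flip_bit b k"
    using assms by (simp add: take_bit_flip_bit_eq take_bit_nat_eq_self)
  then show ?thesis
    by (simp add: take_bit_nat_eq_self_iff)
qed

lemma flip_bit_nat_eq:
  fixes k :: nat
  shows "int (flip_bit b k) = int k + (1 - 2 * (int k div 2 ^ b mod 2)) * 2 ^ b"
proof (induction b arbitrary: k)
  case 0
  then show ?case
    by (cases "even k") (auto elim!: evenE oddE simp: flip_bit_0)
next
  case (Suc b)
  have "int k = int (k mod 2) + 2 * int (k div 2)"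
    by presburger
  moreover have "int (k div 2) div 2 ^ b = int k div 2 ^ Suc b"
    by (simp add: zdiv_int zdiv_zmult2_eq)
  moreover have "int (flip_bit (Suc b) k) = int (k mod 2) + 2 * int (flip_bit b (k div 2))"
    by (simp only: flip_bit_Suc of_nat_add of_nat_mult of_nat_numeral)
  ultimately show ?case
    using Suc[of "k div 2"] by (simp add: algebra_simps)
qed

lemma sum_bin_digit:
  "(\<Sum>k<N. of_int (bin_digit x k) / 2 ^ (k + 1)) = real_of_int \<lfloor>2 ^ N * x\<rfloor> / 2 ^ N - of_int \<lfloor>x\<rfloor>"
proof (induction N)
  case (Suc N)
  have "\<lfloor>2 ^ Suc N * x / real_of_int 2\<rfloor> = \<lfloor>2 ^ Suc N * x\<rfloor> div 2"
    by (rule floor_divide_real_eq_div) simp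
  then have "\<lfloor>2 ^ N * x\<rfloor> = \<lfloor>2 ^ Suc N * x\<rfloor> div 2"
    by simp
  then have "\<lfloor>2 ^ Suc N * x\<rfloor> = 2 * \<lfloor>2 ^ N * x\<rfloor> + bin_digit x N"
    by (simp add: bin_digit_def)
  then have "real_of_int \<lfloor>2 ^ Suc N * x\<rfloor> = 2 * real_of_int \<lfloor>2 ^ N * x\<rfloor> + of_int (bin_digit x N)"
    by (metis of_int_add of_int_mult of_int_numeral)
  then show ?case
    using Suc.IH by (simp add: field_simps)
qed simp

lemma bin_digit_sums:
  assumes "x \<in> {0..<1}"
  shows "(\<lambda>k. of_int (bin_digit x k) / 2 ^ (k + 1)) sums x"
proof -
  have "\<lfloor>x\<rfloor> = 0"
    using assms by (simp add: floor_eq_iff)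
  have "(\<lambda>N. real_of_int \<lfloor>2 ^ N * x\<rfloor> / 2 ^ N) \<longlonglongrightarrow> x"
  proof (rule tendsto_sandwich)
    show "\<forall>\<^sub>F N in sequentially. x - (1/2) ^ N \<le> real_of_int \<lfloor>2 ^ N * x\<rfloor> / 2 ^ N"
    proof (rule always_eventually, rule allI)
      fix N :: nat
      have "2 ^ N * x - 1 \<le> real_of_int \<lfloor>2 ^ N * x\<rfloor>" by linarith
      then show "x - (1/2) ^ N \<le> real_of_int \<lfloor>2 ^ N * x\<rfloor> / 2 ^ N"
        using divide_right_mono[of "2 ^ N * x - 1" "real_of_int \<lfloor>2 ^ N * x\<rfloor>" "2 ^ N"]
        by (simp add: power_one_over diff_divide_distrib)
    qed
    show "\<forall>\<^sub>F N in sequentially. real_of_int \<lfloor>2 ^ N * x\<rfloor> / 2 ^ N \<le> x"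
      by (rule always_eventually) (auto simp: field_simps)
    have "(\<lambda>N. x - (1/2) ^ N) \<longlonglongrightarrow> x - 0"
      by (intro tendsto_intros LIMSEQ_power_zero) auto
    then show "(\<lambda>N. x - (1/2) ^ N) \<longlonglongrightarrow> x" by simp
  qed simp
  then show ?thesis
    using \<open>\<lfloor>x\<rfloor> = 0\<close> unfolding sums_def sum_bin_digit by simp
qed

lemma bin_digit_power: "bin_digit (1 / 2 ^ (j + 1)) k = (if k = j then 1 else 0)"
proof -
  consider "k < j" | "k = j" | "j < k" by linarith
  then show ?thesis
  proof cases
    case 1
    have "(2::real) ^ (k + 1) < 2 ^ (j + 1)" 
      using 1 by (intro power_strict_increasing) auto
    then have "\<lfloor>2 ^ (k + 1) * (1 / 2 ^ (j + 1) :: real)\<rfloor> = 0"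
      by (simp add: floor_eq_iff)
    then show ?thesis
      using 1 by (simp add: bin_digit_def)
  next
    case 2
    then show ?thesis by (simp add: bin_digit_def)
  next
    case 3
    then obtain d where d: "k = j + 1 + d"
      by (metis less_iff_Suc_add add_Suc_right add_Suc Suc_eq_plus1)
    have "2 ^ (k + 1) * (1 / 2 ^ (j + 1) :: real) = of_int (2 ^ (d + 1))"
      by (simp add: d power_add)
    then have "\<lfloor>2 ^ (k + 1) * (1 / 2 ^ (j + 1) :: real)\<rfloor> = 2 ^ (d + 1)"
      by (metis floor_of_int)
    then show ?thesis
      using 3 by (simp add: bin_digit_def)
  qed
qed

text \<open>
  Adding \<open>1 / 2 ^ (j + 1)\<close> without carry is a translation to the right or to the left, depending on
  the digit of \<open>x\<close> at that place.
\<close>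

lemma dyadic_add_power:
  assumes "x \<in> {0..<1}"
  shows "dyadic_add x (1 / 2 ^ (j + 1)) = x + of_int (1 - 2 * bin_digit x j) / 2 ^ (j + 1)"
proof -
  let ?e = "\<lambda>k. if k = j then of_int (1 - 2 * bin_digit x j) / 2 ^ (j + 1) else (0::real)"
  have dig: "bin_digit x k = 0 \<or> bin_digit x k = 1" for k
    by (auto simp: bin_digit_def)
  have "(\<lambda>k. of_int ((bin_digit x k + bin_digit (1 / 2 ^ (j + 1)) k) mod 2) / 2 ^ (k + 1))
    = (\<lambda>k. of_int (bin_digit x k) / 2 ^ (k + 1) + ?e k)"
  proof
    fix k
    show "of_int ((bin_digit x k + bin_digit (1 / 2 ^ (j + 1)) k) mod 2) / 2 ^ (k + 1) 
      = of_int (bin_digit x k) / 2 ^ (k + 1) + ?e k"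
      using dig[of k] unfolding bin_digit_power by auto
  qed
  moreover have "?e sums (of_int (1 - 2 * bin_digit x j) / 2 ^ (j + 1))"
    using sums_single[of j "\<lambda>_. of_int (1 - 2 * bin_digit x j) / 2 ^ (j + 1) :: real"] by simp
  ultimately show ?thesis
    unfolding dyadic_add_def using sums_unique[OF sums_add[OF bin_digit_sums[OF assms]]] by presburger
qed

lemma bin_digit_on_dyadic_interval:
  assumes "x \<in> dyadic_interval n k" "j < n"
  shows "bin_digit x j = int k div 2 ^ (n - 1 - j) mod 2"
proof -
  have x0: "0 \<le> x"
    using assms(1) unfolding dyadic_interval_def
    by (metis atLeastLessThan_iff divide_nonneg_nonneg of_nat_0_le_iff order_trans zero_le_numeral zero_le_power)
  then have k: "dyadic_index n x = k"
    using assms(1) dyadic_index_unique by simp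
  have "drop_bit (n - 1 - j) k = dyadic_index (j + 1) x"
    using drop_bit_dyadic_index[of "n - 1 - j" n x] x0 k assms(2) by simp
  then have "int (k div 2 ^ (n - 1 - j)) = \<lfloor>2 ^ (j + 1) * x\<rfloor>"
    using x0 by (simp add: dyadic_index_def drop_bit_eq_div)
  then show ?thesis
    by (simp add: bin_digit_def zdiv_int)
qed

lemma dyadic_shift_dyadic_interval:
  assumes "k < 2 ^ n" "j < n"
  shows "dyadic_shift (dyadic_interval n k) j = dyadic_interval n (flip_bit (n - 1 - j) k)"
proof -
  define a where "a = (1 - 2 * (int k div 2 ^ (n - 1 - j) mod 2))"
  define k' where "k' = flip_bit (n - 1 - j) k"
  have "int k' = int k + a * 2 ^ (n - 1 - j)"
    unfolding k'_def a_def by (rule flip_bit_nat_eq)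
  then have "real_of_int (int k') = real_of_int (int k + a * 2 ^ (n - 1 - j))"
    by simp
  then have k': "real k' = real k + of_int a * 2 ^ (n - 1 - j)"
    by simp
  have "n = (n - 1 - j) + (j + 1)"
    using assms(2) by simp
  then have n: "(2::real) ^ n = 2 ^ (n - 1 - j) * 2 ^ (j + 1)"
    by (metis power_add)
  have "dyadic_shift (dyadic_interval n k) j = (\<lambda>x. of_int a / 2 ^ (j + 1) + x) ` dyadic_interval n k"
    unfolding dyadic_shift_def
  proof (rule image_cong)
    fix x assume x: "x \<in> dyadic_interval n k"
    then have "x \<in> {0..<1}" using dyadic_interval_subset_unit[OF assms(1)] by blast
    from dyadic_add_power[OF this, of j]
    show "dyadic_add x (1 / 2 ^ (j + 1)) = of_int a / 2 ^ (j + 1) + x"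
      unfolding bin_digit_on_dyadic_interval[OF x assms(2)] a_def[symmetric] by simp
  qed simp
  also have "\<dots> = dyadic_interval n k'"
  proof -
    have "of_int a / 2 ^ (j + 1) = of_int a * 2 ^ (n - 1 - j) / (2 ^ n :: real)"
      unfolding n by simp
    then show ?thesis
      unfolding dyadic_interval_def image_add_atLeastLessThan k'
      by (simp add: add_divide_distrib add_ac)
  qed
  finally show ?thesis
    by (simp add: k'_def)
qed

section \<open>Averages over dyadic intervals and flipped intervals\<close>

lemma dyadic_interval_sets: "k < 2 ^ n \<Longrightarrow> dyadic_interval n k \<in> sets unit_leb"
  using dyadic_interval_subset_unit[of k n]
  by (simp add: sets_restrict_space_iff) (simp add: dyadic_interval_def)

lemma emeasure_dyadic_interval:
  assumes "k < 2 ^ n"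
  shows "emeasure unit_leb (dyadic_interval n k) = ennreal (1 / 2 ^ n)"
proof -
  have "emeasure unit_leb (dyadic_interval n k) = emeasure lborel (dyadic_interval n k)"
    using dyadic_interval_subset_unit[OF assms]
    by (subst emeasure_restrict_space) (auto simp: dyadic_interval_def)
  also have "\<dots> = ennreal (1 / 2 ^ n)"
    by (simp add: dyadic_interval_def divide_right_mono diff_divide_distrib[symmetric])
  finally show ?thesis .
qed

lemma measure_dyadic_interval:
  "k < 2 ^ n \<Longrightarrow> measure unit_leb (dyadic_interval n k) = 1 / 2 ^ n"
  by (simp add: measure_def emeasure_dyadic_interval)

lemma measurable_dyadic_index [measurable]: "dyadic_index n \<in> measurable unit_leb (count_space UNIV)"
proof -
  have "(\<lambda>x::real. x) \<in> borel_measurable unit_leb"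
    by (intro measurable_restrict_space1 measurable_completion) simp
  then show ?thesis
    unfolding dyadic_index_def by measurable
qed

lemma sets_dyadic_index: "{x \<in> {0..<1}. dyadic_index n x \<in> S} \<in> sets unit_leb"
proof -
  have "dyadic_index n -` S \<inter> space unit_leb \<in> sets unit_leb"
    by (rule measurable_sets[OF measurable_dyadic_index]) simp
  moreover have "dyadic_index n -` S \<inter> space unit_leb = {x \<in> {0..<1}. dyadic_index n x \<in> S}"
    by auto
  ultimately show ?thesis by simp
qed

text \<open>
  The average of \<open>h\<close> over the dyadic interval with index \<open>k < 2 ^ n\<close> at level \<open>n\<close>, with values in
  \<open>[0, \<infinity>]\<close>, so that no integrability is required.
\<close>

definition dyadic_avg :: "(real \<Rightarrow> ennreal) \<Rightarrow> nat \<Rightarrow> nat \<Rightarrow> ennreal" where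
  "dyadic_avg h n k = ennreal (2 ^ n) * (\<integral>\<^sup>+x\<in>dyadic_interval n k. h x \<partial>unit_leb)"

lemma indicator_dyadic_index:
  assumes "x \<in> {0..<1}" "finite S"
  shows "(indicator {x \<in> {0..<1}. dyadic_index n x \<in> S} x :: ennreal)
    = (\<Sum>k\<in>S. indicator (dyadic_interval n k) x)"
proof -
  have "(\<Sum>k\<in>S. indicator (dyadic_interval n k) x) = (\<Sum>k\<in>S. if dyadic_index n x = k then 1 else (0::ennreal))"
    using assms by (intro sum.cong) (auto simp: dyadic_index_unique indicator_def)
  also have "\<dots> = (if dyadic_index n x \<in> S then 1 else 0)"
    using assms by (simp add: sum.delta)
  finally show ?thesis
    using assms by (auto simp: indicator_def)
qed

lemma nn_integral_dyadic_index:
  assumes [measurable]: "h \<in> borel_measurable unit_leb" and "S \<subseteq> {..<2 ^ n}"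
  shows "(\<integral>\<^sup>+x. h x * indicator {x \<in> {0..<1}. dyadic_index n x \<in> S} x \<partial>unit_leb)
    = (\<Sum>k\<in>S. \<integral>\<^sup>+x\<in>dyadic_interval n k. h x \<partial>unit_leb)"
proof -
  have S: "finite S"
    using assms(2) finite_subset by blast
  have [measurable]: "dyadic_interval n k \<in> sets unit_leb" if "k \<in> S" for k
    using assms(2) that by (intro dyadic_interval_sets) auto
  have "(\<integral>\<^sup>+x. h x * indicator {x \<in> {0..<1}. dyadic_index n x \<in> S} x \<partial>unit_leb)
    = (\<integral>\<^sup>+x. (\<Sum>k\<in>S. h x * indicator (dyadic_interval n k) x) \<partial>unit_leb)"
    by (intro nn_integral_cong)
       (simp only: space_restrict_space space_completion space_lborel space_borel Int_UNIV_right
         indicator_dyadic_index[OF _ S] sum_distrib_left)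
  also have "\<dots> = (\<Sum>k\<in>S. \<integral>\<^sup>+x\<in>dyadic_interval n k. h x \<partial>unit_leb)"
    by (rule nn_integral_sum) measurable
  finally show ?thesis .
qed

lemma emeasure_dyadic_index_le:
  assumes "finite S"
  shows "emeasure unit_leb {x \<in> {0..<1}. dyadic_index n x \<in> S} \<le> ennreal (card S / 2 ^ n)"
proof -
  let ?S = "S \<inter> {..<2 ^ n}"
  have eq: "{x \<in> {0..<1}. dyadic_index n x \<in> S} = {x \<in> {0..<1}. dyadic_index n x \<in> ?S}"
    using dyadic_index_less by auto
  have "emeasure unit_leb {x \<in> {0..<1}. dyadic_index n x \<in> S}
    = (\<integral>\<^sup>+x. 1 * indicator {x \<in> {0..<1}. dyadic_index n x \<in> ?S} x \<partial>unit_leb)"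
    unfolding eq using sets_dyadic_index[of n ?S] by (simp only: mult_1 nn_integral_indicator)
  also have "\<dots> = (\<Sum>k\<in>?S. \<integral>\<^sup>+x. 1 * indicator (dyadic_interval n k) x \<partial>unit_leb)"
    by (rule nn_integral_dyadic_index) auto
  also have "\<dots> = (\<Sum>k\<in>?S. ennreal (1 / 2 ^ n))"
    by (intro sum.cong refl) (simp add: dyadic_interval_sets emeasure_dyadic_interval)
  also have "\<dots> = ennreal (card ?S / 2 ^ n)"
    by (simp add: ennreal_of_nat_eq_real_of_nat ennreal_mult[symmetric])
  also have "\<dots> \<le> ennreal (card S / 2 ^ n)"
    using assms by (intro ennreal_leI divide_right_mono) (auto intro: card_mono)
  finally show ?thesis .
qed

text \<open>
  The stopping intervals at level \<open>n\<close>: those over which the average of \<open>h\<close> exceeds \<open>l\<close>, while over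
  all their dyadic ancestors it does not. The union of the intervals over all \<open>n\<close> is the set where
  the dyadic maximal function of \<open>h\<close> exceeds \<open>l\<close>.
\<close>

definition first_exceed :: "(real \<Rightarrow> ennreal) \<Rightarrow> real \<Rightarrow> nat \<Rightarrow> nat set" where
  "first_exceed h l n = {k. k < 2 ^ n \<and> ennreal l < dyadic_avg h n k \<and>
     (\<forall>m<n. dyadic_avg h m (drop_bit (n - m) k) \<le> ennreal l)}"

lemma finite_first_exceed [simp]: "finite (first_exceed h l n)"
  by (rule finite_subset[of _ "{..<2 ^ n}"]) (auto simp: first_exceed_def)

text \<open>
  The left-hand side is the total length of the stopping intervals, which are pairwise disjoint.
\<close>

lemma first_exceed_sum:
  assumes [measurable]: "h \<in> borel_measurable unit_leb" and "0 < l"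
  shows "(\<Sum>n. ennreal (card (first_exceed h l n) / 2 ^ n)) \<le> ennreal (1 / l) * (\<integral>\<^sup>+x. h x \<partial>unit_leb)"
proof -
  let ?T = "first_exceed h l"
  define F where "F n = {x \<in> {0..<1}. dyadic_index n x \<in> ?T n}" for n
  have [measurable]: "F n \<in> sets unit_leb" for n
    unfolding F_def by (rule sets_dyadic_index)
  have disj': False if "x \<in> F n" "x \<in> F m" "n < m" for x n m
  proof -
    have "drop_bit (m - n) (dyadic_index m x) = dyadic_index n x"
      using that by (subst drop_bit_dyadic_index) (auto simp: F_def)
    then have "dyadic_avg h n (dyadic_index n x) \<le> ennreal l"
      using that by (auto simp: F_def first_exceed_def)
    then show False
      using that by (auto simp: F_def first_exceed_def)
  qed
  have disj: "disjoint_family F"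
    unfolding disjoint_family_on_def
    by (metis (no_types) disj' disjoint_iff linorder_neqE_nat)
  have term_le: "ennreal (card (?T n) / 2 ^ n) \<le> ennreal (1 / l) * (\<integral>\<^sup>+x. h x * indicator (F n) x \<partial>unit_leb)" for n
  proof -
    have "ennreal (1 / 2 ^ n) \<le> ennreal (1 / l) * (\<integral>\<^sup>+x\<in>dyadic_interval n k. h x \<partial>unit_leb)"
      if "k \<in> ?T n" for k
    proof -
      have "ennreal (1 / l) * ennreal (1 / 2 ^ n) * ennreal l
        \<le> ennreal (1 / l) * ennreal (1 / 2 ^ n) * dyadic_avg h n k"
        using that by (intro mult_left_mono) (auto simp: first_exceed_def)
      also have "\<dots> = ennreal (1 / l) * ((ennreal (1 / 2 ^ n) * ennreal (2 ^ n)) * (\<integral>\<^sup>+x\<in>dyadic_interval n k. h x \<partial>unit_leb))"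
        by (simp add: dyadic_avg_def mult.assoc)
      also have "ennreal (1 / 2 ^ n) * ennreal (2 ^ n) = 1"
        by (subst ennreal_mult[symmetric]) auto
      also have "ennreal (1 / l) * ennreal (1 / 2 ^ n) * ennreal l = ennreal (1 / 2 ^ n)"
        using \<open>0 < l\<close> by (simp add: ennreal_mult[symmetric])
      finally show ?thesis by simp
    qed
    then have "(\<Sum>k\<in>?T n. ennreal (1 / 2 ^ n))
      \<le> (\<Sum>k\<in>?T n. ennreal (1 / l) * (\<integral>\<^sup>+x\<in>dyadic_interval n k. h x \<partial>unit_leb))"
      by (rule sum_mono)
    also have "\<dots> = ennreal (1 / l) * (\<integral>\<^sup>+x. h x * indicator (F n) x \<partial>unit_leb)"
      unfolding F_def 
      by (subst nn_integral_dyadic_index) (auto simp: first_exceed_def sum_distrib_left)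
    also have "(\<Sum>k\<in>?T n. ennreal (1 / 2 ^ n)) = ennreal (card (?T n) / 2 ^ n)"
      by (simp add: ennreal_of_nat_eq_real_of_nat ennreal_mult[symmetric])
    finally show ?thesis .
  qed
  have "(\<Sum>n. ennreal (card (?T n) / 2 ^ n))
    \<le> (\<Sum>n. ennreal (1 / l) * (\<integral>\<^sup>+x. h x * indicator (F n) x \<partial>unit_leb))"
    by (intro suminf_le term_le) auto
  also have "\<dots> = ennreal (1 / l) * (\<Sum>n. \<integral>\<^sup>+x. h x * indicator (F n) x \<partial>unit_leb)"
    by simp
  also have "(\<Sum>n. \<integral>\<^sup>+x. h x * indicator (F n) x \<partial>unit_leb)
    = (\<integral>\<^sup>+x. (\<Sum>n. h x * indicator (F n) x) \<partial>unit_leb)"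
    by (rule nn_integral_suminf[symmetric]) measurable
  also have "\<dots> = (\<integral>\<^sup>+x. h x * indicator (\<Union>n. F n) x \<partial>unit_leb)"
    using suminf_indicator[OF disj] by (intro nn_integral_cong) simp
  also have "ennreal (1 / l) * \<dots> \<le> ennreal (1 / l) * (\<integral>\<^sup>+x. h x \<partial>unit_leb)"
    by (intro mult_left_mono nn_integral_mono) (auto simp: indicator_def)
  finally show ?thesis .
qed

text \<open>
  Here the flipped digit stays at distance \<open>b\<close> from the last one. The union of the stopping intervals
  and of their images under \<open>flip_bit c\<close> for \<open>c \<le> b\<close>, which makes \<open>b + 2\<close> sets of equal size at each level,
  covers the set in question.
\<close>

lemma flipped_avg_weak_type:
  assumes [measurable]: "h \<in> borel_measurable unit_leb" and "0 < l"
  shows "emeasure unit_leb {x \<in> {0..<1}. \<exists>n>b. ennreal l < dyadic_avg h n (flip_bit b (dyadic_index n x))}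
    \<le> ennreal (real (b + 2) / l) * (\<integral>\<^sup>+x. h x \<partial>unit_leb)"
proof -
  let ?T = "first_exceed h l"
  \<comment> \<open>The index \<open>c = 0\<close> stands for no flip, and \<open>c\<close> for the flip of bit \<open>c - 1\<close> otherwise.\<close>
  define G where "G n c = {x \<in> {0..<1}. dyadic_index n x \<in> (if c = 0 then ?T n else flip_bit (c - 1) ` ?T n)}" for n c
  have [measurable]: "G n c \<in> sets unit_leb" for n c
    unfolding G_def by (rule sets_dyadic_index)
  have G_le: "emeasure unit_leb (G n c) \<le> ennreal (card (?T n) / 2 ^ n)" for n c
  proof -
    let ?S = "if c = 0 then ?T n else flip_bit (c - 1) ` ?T n"
    have "emeasure unit_leb (G n c) \<le> ennreal (card ?S / 2 ^ n)"
      unfolding G_def by (rule emeasure_dyadic_index_le) simp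
    also have "\<dots> \<le> ennreal (card (?T n) / 2 ^ n)"
      by (intro ennreal_leI divide_right_mono) (auto intro: card_image_le)
    finally show ?thesis .
  qed
  have "{x \<in> {0..<1}. \<exists>n>b. ennreal l < dyadic_avg h n (flip_bit b (dyadic_index n x))} \<subseteq> (\<Union>n. \<Union>c<b + 2. G n c)"
  proof safe
    fix x n assume x: "x \<in> {0..<1::real}" and n: "b < n"
      and gt: "ennreal l < dyadic_avg h n (flip_bit b (dyadic_index n x))"
    define k where "k = flip_bit b (dyadic_index n x)"
    have k: "k < 2 ^ n"
      unfolding k_def using x n by (intro flip_bit_less dyadic_index_less) auto
    define Q where "Q m \<longleftrightarrow> m \<le> n \<and> ennreal l < dyadic_avg h m (drop_bit (n - m) k)" for m
    \<comment> \<open>The first level at which the flipped interval or one of its ancestors is stopped.\<close>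
    define m where "m = (LEAST m. Q m)"
    have "Q n"
      using gt by (simp add: Q_def k_def)
    then have m: "Q m" and least: "\<And>i. i < m \<Longrightarrow> \<not> Q i"
      unfolding m_def by (auto intro: LeastI dest: not_less_Least)
    define r where "r = n - m"
    have mn: "m \<le> n" using m by (simp add: Q_def)
    have idx: "drop_bit r (dyadic_index n x) = dyadic_index m x"
      using mn x by (subst drop_bit_dyadic_index) (auto simp: r_def)
    have "drop_bit r k < 2 ^ m"
    proof -
      have "k < 2 ^ m * 2 ^ r"
        using k mn by (simp add: r_def power_add[symmetric])
      then show ?thesis
        by (simp add: drop_bit_eq_div less_mult_imp_div_less)
    qed
    moreover have "ennreal l < dyadic_avg h m (drop_bit r k)"
      using m by (simp add: Q_def r_def)
    moreover have "dyadic_avg h i (drop_bit (m - i) (drop_bit r k)) \<le> ennreal l" if "i < m" for i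
      using least[OF that] that mn by (auto simp: Q_def r_def not_less)
    ultimately have T: "drop_bit r k \<in> ?T m"
      by (auto simp: first_exceed_def)
    show "x \<in> (\<Union>n. \<Union>c<b + 2. G n c)"
    proof (cases "r \<le> b")
      case True
      then have "drop_bit r k = flip_bit (b - r) (dyadic_index m x)"
        by (simp add: k_def drop_bit_flip_bit_nat idx)
      then have "dyadic_index m x = flip_bit (b - r) (drop_bit r k)"
        by (simp add: flip_bit_involution)
      then have "x \<in> G m (b - r + 1)"
        using T x by (auto simp: G_def)
      then show ?thesis by (auto intro!: bexI[of _ "b - r + 1"])
    next
      case False
      then have "drop_bit r k = dyadic_index m x"
        by (simp add: k_def drop_bit_flip_bit_nat idx)
      then have "x \<in> G m 0"
        using T x by (auto simp: G_def)
      then show ?thesis by force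
    qed
  qed
  then have "emeasure unit_leb {x \<in> {0..<1}. \<exists>n>b. ennreal l < dyadic_avg h n (flip_bit b (dyadic_index n x))}
    \<le> emeasure unit_leb (\<Union>n. \<Union>c<b + 2. G n c)"
    by (rule emeasure_mono) measurable
  also have "\<dots> \<le> (\<Sum>n. emeasure unit_leb (\<Union>c<b + 2. G n c))"
    by (rule emeasure_subadditive_countably) auto
  also have "\<dots> \<le> (\<Sum>n. ennreal (b + 2) * ennreal (card (?T n) / 2 ^ n))"
  proof (intro suminf_le allI)
    fix n
    have "emeasure unit_leb (\<Union>c<b + 2. G n c) \<le> (\<Sum>c<b + 2. emeasure unit_leb (G n c))"
      by (rule emeasure_subadditive_finite) auto
    also have "\<dots> \<le> (\<Sum>c<b + 2. ennreal (card (?T n) / 2 ^ n))"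
      by (intro sum_mono G_le)
    also have "\<dots> = ennreal (b + 2) * ennreal (card (?T n) / 2 ^ n)"
      by (simp only: sum_constant card_lessThan ennreal_of_nat_eq_real_of_nat)
    finally show "emeasure unit_leb (\<Union>c<b + 2. G n c) \<le> ennreal (b + 2) * ennreal (card (?T n) / 2 ^ n)" .
  qed auto
  also have "\<dots> = ennreal (b + 2) * (\<Sum>n. ennreal (card (?T n) / 2 ^ n))"
    by simp
  also have "\<dots> \<le> ennreal (b + 2) * (ennreal (1 / l) * (\<integral>\<^sup>+x. h x \<partial>unit_leb))"
    using assms by (intro mult_left_mono first_exceed_sum) auto
  also have "\<dots> = ennreal (real (b + 2) / l) * (\<integral>\<^sup>+x. h x \<partial>unit_leb)"
    using \<open>0 < l\<close> by (simp add: mult.assoc[symmetric] ennreal_mult[symmetric] del: of_nat_add ennreal_plus)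
  finally show ?thesis .
qed

section \<open>The flipped dyadic maximal operator at a constant exponent\<close>

text \<open>
  A maximal function over the intervals obtained from those around \<open>x\<close> by flipping one digit, damped
  by the distance \<open>b + 1\<close> between the level of the interval and the level of the smallest dyadic
  interval that contains both \<open>x\<close> and the flipped interval.
\<close>

definition flip_max :: "real \<Rightarrow> (real \<Rightarrow> ennreal) \<Rightarrow> real \<Rightarrow> ennreal" where
  "flip_max e h x = (SUP (n, b) \<in> {(n, b). b < n}.
     ennreal (2 powr (- e * real (b + 1))) * dyadic_avg h n (flip_bit b (dyadic_index n x)))"

text \<open>
  The weak type constant of \<open>flip_max\<close>: the constants \<open>b + 2\<close> for the single flips, summed against
  the damping.
\<close>

definition flip_const :: "real \<Rightarrow> real" where
  "flip_const e = (\<Sum>b. real (b + 2) * 2 powr (- e * real (b + 1)))"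

lemma summable_flip_const:
  assumes "0 < e"
  shows "summable (\<lambda>b. real (b + 2) * 2 powr (- e * real (b + 1)))"
proof (rule summable_comparison_test')
  define z where "z = 2 powr (- e)"
  have z: "0 < z" "z < 1"
    using assms powr_less_mono[of "-e" 0 2] by (auto simp: z_def)
  have "summable (\<lambda>b. of_nat (Suc b) * z ^ b)"
    using geometric_deriv_sums[of z] z by (auto simp: sums_iff)
  then show "summable (\<lambda>b. 2 * (of_nat (Suc b) * z ^ b))"
    by (rule summable_mult)
  fix b :: nat
  have "2 powr (- e * real (b + 1)) = z ^ (b + 1)"
    unfolding z_def by (subst powr_power) (auto simp: mult.commute)
  also have "\<dots> \<le> z ^ b"
    using z by (simp add: mult_left_le_one_le)
  finally have "real (b + 2) * 2 powr (- e * real (b + 1)) \<le> (2 * real (Suc b)) * z ^ b"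
    by (intro mult_mono) auto
  also have "\<dots> = 2 * (of_nat (Suc b) * z ^ b)"
    by (rule mult.assoc)
  finally have "real (b + 2) * 2 powr (- e * real (b + 1)) \<le> 2 * (of_nat (Suc b) * z ^ b)" .
  then show "norm (real (b + 2) * 2 powr (- e * real (b + 1))) \<le> 2 * (of_nat (Suc b) * z ^ b)"
    by (subst real_norm_def, subst abs_of_nonneg) auto
qed

lemma flip_const_nonneg: "0 < e \<Longrightarrow> 0 \<le> flip_const e"
  unfolding flip_const_def by (intro suminf_nonneg summable_flip_const) auto

lemma measurable_flipped_avg [measurable]:
  "(\<lambda>x. dyadic_avg h n (flip_bit b (dyadic_index n x))) \<in> borel_measurable unit_leb"
  by (rule measurable_compose[OF measurable_dyadic_index]) simp

lemma measurable_flip_max [measurable]: "flip_max e h \<in> borel_measurable unit_leb"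
  unfolding flip_max_def case_prod_beta
  by (intro borel_measurable_SUP countableI_type) measurable

text \<open>
  The factor \<open>2\<close> allows for truncation: the part of \<open>g\<close> below \<open>l\<close> contributes at most \<open>l\<close> to any
  average, so only the part above \<open>l\<close> is needed on the right.
\<close>

lemma flip_max_weak_type:
  fixes g :: "real \<Rightarrow> real"
  assumes [measurable]: "g \<in> borel_measurable unit_leb" and l: "0 < l" and e: "0 < e"
  shows "emeasure unit_leb {x \<in> {0..<1}. ennreal (2 * l) < flip_max e g x}
    \<le> ennreal (flip_const e / l) * (\<integral>\<^sup>+x. ennreal (g x) * indicator {x. l < g x} x \<partial>unit_leb)"
proof -
  define h where "h x = ennreal (g x) * indicator {x. l < g x} x" for x
  have h_eq: "h = (\<lambda>x. ennreal (if l < g x then g x else 0))"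
    by (auto simp: h_def fun_eq_iff indicator_def)
  have [measurable]: "h \<in> borel_measurable unit_leb"
    unfolding h_eq by measurable
  define E where "E b = 2 powr (e * real (b + 1))" for b :: nat
  have E: "1 \<le> E b" "2 powr (- e * real (b + 1)) = 1 / E b" for b
    using e by (auto simp: E_def ge_one_powr_ge_zero powr_minus_divide)
  define G where "G b = {x \<in> {0..<1}. \<exists>n>b. ennreal (l * E b) < dyadic_avg h n (flip_bit b (dyadic_index n x))}" for b
  have [measurable]: "G b \<in> sets unit_leb" for b
  proof -
    have "{x \<in> space unit_leb. \<exists>n>b. ennreal (l * E b) < dyadic_avg h n (flip_bit b (dyadic_index n x))} \<in> sets unit_leb"
      by measurable
    then show ?thesis by (simp add: G_def)
  qed
  have avg: "dyadic_avg g n k \<le> ennreal l + dyadic_avg h n k" if "k < 2 ^ n" for n k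
  proof -
    note [measurable] = dyadic_interval_sets[OF that]
    have "(\<integral>\<^sup>+x\<in>dyadic_interval n k. ennreal (g x) \<partial>unit_leb)
      \<le> (\<integral>\<^sup>+x. ennreal l * indicator (dyadic_interval n k) x + h x * indicator (dyadic_interval n k) x \<partial>unit_leb)"
      using l by (intro nn_integral_mono) (auto simp: h_eq indicator_def ennreal_leI)
    also have "\<dots> = ennreal l * ennreal (1 / 2 ^ n) + (\<integral>\<^sup>+x\<in>dyadic_interval n k. h x \<partial>unit_leb)"
      by (subst nn_integral_add) (auto simp: nn_integral_cmult emeasure_dyadic_interval[OF that])
    finally have "dyadic_avg g n k \<le> ennreal (2 ^ n) * (ennreal l * ennreal (1 / 2 ^ n) + (\<integral>\<^sup>+x\<in>dyadic_interval n k. h x \<partial>unit_leb))"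
      unfolding dyadic_avg_def by (rule mult_left_mono) simp
    also have "\<dots> = ennreal l + dyadic_avg h n k"
      using l by (simp add: dyadic_avg_def distrib_left ennreal_mult[symmetric])
    finally show ?thesis .
  qed
  have "{x \<in> {0..<1}. ennreal (2 * l) < flip_max e g x} \<subseteq> (\<Union>b. G b)"
  proof safe
    fix x assume x: "x \<in> {0..<1::real}" and gt0: "ennreal (2 * l) < flip_max e g x"
    from gt0 obtain nb where nb: "nb \<in> {(n, b). b < n}" "ennreal (2 * l) < (case nb of (n, b) \<Rightarrow>
        ennreal (2 powr (- e * real (b + 1))) * dyadic_avg g n (flip_bit b (dyadic_index n x)))"
      unfolding flip_max_def by (rule less_SUP_iff[THEN iffD1, THEN bexE])
    obtain n b where "nb = (n, b)" by (cases nb)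
    with nb have b: "b < n"
      and gt: "ennreal (2 * l) < ennreal (1 / E b) * dyadic_avg g n (flip_bit b (dyadic_index n x))"
      unfolding E(2)[symmetric] by auto
    have "ennreal (l * E b) < dyadic_avg h n (flip_bit b (dyadic_index n x))"
    proof (rule ccontr)
      assume "\<not> ?thesis"
      then have "ennreal l + dyadic_avg h n (flip_bit b (dyadic_index n x)) \<le> ennreal l + ennreal (l * E b)"
        by (intro add_left_mono) simp
      also have "\<dots> = ennreal (l + l * E b)"
        using l E(1)[of b] by simp
      finally have "dyadic_avg g n (flip_bit b (dyadic_index n x)) \<le> ennreal (l + l * E b)"
        using avg[OF flip_bit_less[OF dyadic_index_less[OF x] b]] by (rule order_trans[rotated])
      then have "ennreal (1 / E b) * dyadic_avg g n (flip_bit b (dyadic_index n x)) \<le> ennreal (1 / E b) * ennreal (l + l * E b)"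
        by (rule mult_left_mono) simp
      also have "\<dots> = ennreal (1 / E b * (l + l * E b))"
        using l E(1)[of b] by (intro ennreal_mult[symmetric]) auto
      also have "\<dots> \<le> ennreal (2 * l)"
        using l E(1)[of b] by (intro ennreal_leI) (simp add: field_simps)
      finally show False using gt by simp
    qed
    then show "x \<in> (\<Union>b. G b)"
      using x b by (auto simp: G_def)
  qed
  then have "emeasure unit_leb {x \<in> {0..<1}. ennreal (2 * l) < flip_max e g x} \<le> emeasure unit_leb (\<Union>b. G b)"
    by (rule emeasure_mono) measurable
  also have "\<dots> \<le> (\<Sum>b. emeasure unit_leb (G b))"
    by (rule emeasure_subadditive_countably) auto
  also have "\<dots> \<le> (\<Sum>b. ennreal (real (b + 2) * 2 powr (- e * real (b + 1)) / l) * (\<integral>\<^sup>+x. h x \<partial>unit_leb))"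
  proof (intro suminf_le allI)
    fix b
    have "emeasure unit_leb (G b) \<le> ennreal (real (b + 2) / (l * E b)) * (\<integral>\<^sup>+x. h x \<partial>unit_leb)"
      unfolding G_def using l E(1)[of b] by (intro flipped_avg_weak_type) auto
    also have "real (b + 2) / (l * E b) = real (b + 2) * 2 powr (- e * real (b + 1)) / l"
      unfolding E(2) by simp
    finally show "emeasure unit_leb (G b) \<le> ennreal (real (b + 2) * 2 powr (- e * real (b + 1)) / l) * (\<integral>\<^sup>+x. h x \<partial>unit_leb)" .
  qed auto
  also have "\<dots> = (\<Sum>b. ennreal (real (b + 2) * 2 powr (- e * real (b + 1)) / l)) * (\<integral>\<^sup>+x. h x \<partial>unit_leb)"
    by simp
  also have "(\<Sum>b. ennreal (real (b + 2) * 2 powr (- e * real (b + 1)) / l)) = ennreal (flip_const e / l)"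
  proof (rule suminf_ennreal_eq)
    show "(\<lambda>b. real (b + 2) * 2 powr (- e * real (b + 1)) / l) sums (flip_const e / l)"
      unfolding flip_const_def by (intro sums_divide summable_sums summable_flip_const e)
  qed (use l in simp)
  finally show ?thesis
    by (simp add: h_def)
qed

text \<open>
  A geometric sum stopped at the last \<open>k\<close> with \<open>2 ^ k < y\<close> is comparable to its largest term.
\<close>

lemma sum_powr_below:
  fixes a y :: real
  assumes "0 < a" "0 \<le> y"
  shows "(\<Sum>k<N. if 2 ^ k < y then 2 powr (real k * a) else 0) \<le> 2 powr a / (2 powr a - 1) * y powr a"
proof (induction N)
  case 0
  have "1 < 2 powr a" using assms by simp
  then show ?case by simp
next
  case (Suc N)
  define q where "q = 2 powr a"
  have q: "1 < q" using assms by (simp add: q_def)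
  have qk: "2 powr (real k * a) = q ^ k" for k
    by (simp add: q_def powr_power mult.commute)
  show ?case
  proof (cases "2 ^ N < y")
    case True
    have "(\<Sum>k<Suc N. if 2 ^ k < y then 2 powr (real k * a) else 0) = (\<Sum>k<Suc N. q ^ k)"
    proof (intro sum.cong refl)
      fix k assume "k \<in> {..<Suc N}"
      then have "(2::real) ^ k \<le> 2 ^ N" by (intro power_increasing) auto
      with True have "2 ^ k < y" by (rule le_less_trans[rotated])
      then show "(if 2 ^ k < y then 2 powr (real k * a) else 0) = q ^ k"
        using qk by simp
    qed
    also have "\<dots> = (q ^ Suc N - 1) / (q - 1)"
      using q by (subst geometric_sum) auto
    also have "\<dots> \<le> q ^ Suc N / (q - 1)"
      using q by (intro divide_right_mono) auto
    also have "\<dots> = q / (q - 1) * q ^ N" by simp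
    also have "q ^ N = (2 ^ N) powr a"
      by (simp add: q_def powr_power powr_powr mult.commute flip: powr_realpow)
    also have "q / (q - 1) * (2 ^ N) powr a \<le> q / (q - 1) * y powr a"
      using q True assms by (intro mult_left_mono powr_mono2) auto
    finally show ?thesis by (simp add: q_def)
  next
    case False
    then show ?thesis using Suc by simp
  qed
qed

lemma suminf_powr_below:
  fixes a y :: real
  assumes "0 < a" "0 \<le> y"
  shows "(\<Sum>k. ennreal (if 2 ^ k < y then 2 powr (real k * a) else 0)) \<le> ennreal (2 powr a / (2 powr a - 1) * y powr a)"
  unfolding suminf_eq_SUP
proof (rule SUP_least)
  fix N
  have "(\<Sum>k<N. ennreal (if 2 ^ k < y then 2 powr (real k * a) else 0))
    = ennreal (\<Sum>k<N. if 2 ^ k < y then 2 powr (real k * a) else 0)"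
    by (rule sum_ennreal) auto
  also have "\<dots> \<le> ennreal (2 powr a / (2 powr a - 1) * y powr a)"
    by (rule ennreal_leI[OF sum_powr_below[OF assms]])
  finally show "(\<Sum>k<N. ennreal (if 2 ^ k < y then 2 powr (real k * a) else 0)) \<le> \<dots>" .
qed

text \<open>
  A discrete layer cake bound. Because of the maximum with \<open>1\<close> only the levels \<open>2 * 2 ^ k\<close> with
  \<open>k \<ge> 0\<close> are needed.
\<close>

lemma ennreal_powr_layers:
  fixes w :: ennreal
  assumes "1 \<le> P"
  shows "ennreal_powr (max 1 w) P
    \<le> ennreal (4 powr P) * (1 + (\<Sum>k. ennreal (2 powr (real k * P)) * of_bool (ennreal (2 * 2 ^ k) < w)))"
proof (cases w)
  case top
  have "of_nat N \<le> (\<Sum>k. ennreal (2 powr (real k * P)) * of_bool (ennreal (2 * 2 ^ k) < w))" for N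
  proof -
    have "of_nat N = (\<Sum>k<N. 1::ennreal)" by simp
    also have "\<dots> \<le> (\<Sum>k<N. ennreal (2 powr (real k * P)) * of_bool (ennreal (2 * 2 ^ k) < w))"
      using assms top by (intro sum_mono) (auto simp: ge_one_powr_ge_zero)
    also have "\<dots> \<le> (\<Sum>k. ennreal (2 powr (real k * P)) * of_bool (ennreal (2 * 2 ^ k) < w))"
      by (rule sum_le_suminf) auto
    finally show ?thesis .
  qed
  then have "\<not> (\<Sum>k. ennreal (2 powr (real k * P)) * of_bool (ennreal (2 * 2 ^ k) < w)) < top"
    using ennreal_Ex_less_of_nat leD by blast
  then have "(\<Sum>k. ennreal (2 powr (real k * P)) * of_bool (ennreal (2 * 2 ^ k) < w)) = top"
    by (simp add: less_top[symmetric])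
  then show ?thesis
    by (simp add: ennreal_mult_top)
next
  case (real r)
  have max_eq: "max 1 w = ennreal (max 1 r)"
    using real by (simp add: max_def)
  have pw: "ennreal_powr (max 1 w) P = ennreal (max 1 r powr P)"
    unfolding max_eq by (simp add: ennreal_powr_def)
  show ?thesis
  proof (cases "r \<le> 2")
    case True
    then have "ennreal (max 1 r powr P) \<le> ennreal (4 powr P) * 1"
      using assms by (auto intro!: ennreal_leI powr_mono2)
    also have "\<dots> \<le> ennreal (4 powr P) * (1 + (\<Sum>k. ennreal (2 powr (real k * P)) * of_bool (ennreal (2 * 2 ^ k) < w)))"
      by (intro mult_left_mono) auto
    finally show ?thesis by (simp only: pw)
  next
    case False
    define N where "N = (LEAST N. r \<le> 2 * 2 ^ N)"
    obtain M where "r < 2 ^ M"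
      using real_arch_pow[of 2 r] by auto
    then have "r \<le> 2 * 2 ^ M" using False by auto
    then have N: "r \<le> 2 * 2 ^ N" unfolding N_def by (rule LeastI)
    then have "N \<noteq> 0" using False by (cases N) auto
    then obtain k where k: "N = Suc k" by (cases N) auto
    have rk: "2 * 2 ^ k < r"
      using not_less_Least[of k "\<lambda>N. r \<le> 2 * 2 ^ N"] k by (auto simp: N_def)
    have "max 1 r powr P \<le> (4 * 2 ^ k) powr P"
      using N k False assms by (intro powr_mono2) auto
    also have "\<dots> = 4 powr P * 2 powr (real k * P)"
      by (simp add: powr_mult powr_powr flip: powr_realpow)
    finally have "ennreal (max 1 r powr P) \<le> ennreal (4 powr P) * ennreal (2 powr (real k * P))"
      by (simp add: ennreal_mult[symmetric] ennreal_leI)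
    also have "ennreal (2 powr (real k * P)) = (\<Sum>k\<in>{k}. ennreal (2 powr (real k * P)) * of_bool (ennreal (2 * 2 ^ k) < w))"
      using rk real by (simp add: ennreal_less_iff)
    also have "\<dots> \<le> (\<Sum>k. ennreal (2 powr (real k * P)) * of_bool (ennreal (2 * 2 ^ k) < w))"
      by (rule sum_le_suminf) auto
    also have "\<dots> \<le> 1 + \<dots>" by simp
    finally show ?thesis
      unfolding pw by (simp add: mult_left_mono)
  qed
qed

lemma flip_max_strong_type:
  fixes g :: "real \<Rightarrow> real"
  assumes [measurable]: "g \<in> borel_measurable unit_leb" and g0: "\<And>x. 0 \<le> g x"
    and P: "1 < P" and e: "0 < e"
  shows "(\<integral>\<^sup>+x. ennreal_powr (max 1 (flip_max e g x)) P \<partial>unit_leb)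
    \<le> ennreal (4 powr P) * (1 + ennreal (flip_const e * (2 powr (P - 1) / (2 powr (P - 1) - 1)))
        * (\<integral>\<^sup>+x. ennreal (g x powr P) \<partial>unit_leb))"
proof -
  define c where "c = 2 powr (P - 1) / (2 powr (P - 1) - 1)"
  have "1 < 2 powr (P - 1)" using P by simp
  then have c: "0 \<le> c" by (simp add: c_def)
  let ?W = "flip_max e g"
  let ?L = "\<lambda>k x. ennreal (2 powr (real k * P)) * of_bool (ennreal (2 * 2 ^ k) < ?W x)"
  have [measurable]: "(\<lambda>x. (of_bool (ennreal (2 * 2 ^ k) < ?W x)::ennreal)) \<in> borel_measurable unit_leb" for k
    by measurable
  have layer: "(\<integral>\<^sup>+x. ?L k x \<partial>unit_leb)
    \<le> ennreal (flip_const e) * (\<integral>\<^sup>+x. ennreal (g x * (if 2 ^ k < g x then 2 powr (real k * (P - 1)) else 0)) \<partial>unit_leb)" for k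
  proof -
    have sets: "{x \<in> {0..<1}. ennreal (2 * 2 ^ k) < ?W x} \<in> sets unit_leb"
    proof -
      have "{x \<in> space unit_leb. ennreal (2 * 2 ^ k) < ?W x} \<in> sets unit_leb" by measurable
      then show ?thesis by simp
    qed
    have "(\<integral>\<^sup>+x. ?L k x \<partial>unit_leb)
      = (\<integral>\<^sup>+x. ennreal (2 powr (real k * P)) * indicator {x \<in> {0..<1}. ennreal (2 * 2 ^ k) < ?W x} x \<partial>unit_leb)"
      by (intro nn_integral_cong) (auto simp: indicator_def)
    also have "\<dots> = ennreal (2 powr (real k * P)) * emeasure unit_leb {x \<in> {0..<1}. ennreal (2 * 2 ^ k) < ?W x}"
      using sets by (rule nn_integral_cmult_indicator)
    also have "\<dots> \<le> ennreal (2 powr (real k * P)) * (ennreal (flip_const e / 2 ^ k)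
        * (\<integral>\<^sup>+x. ennreal (g x) * indicator {x. 2 ^ k < g x} x \<partial>unit_leb))"
      using e by (intro mult_left_mono flip_max_weak_type) auto
    also have "\<dots> = ennreal (2 powr (real k * P) * (flip_const e / 2 ^ k))
        * (\<integral>\<^sup>+x. ennreal (g x) * indicator {x. 2 ^ k < g x} x \<partial>unit_leb)"
      using flip_const_nonneg[OF e] by (subst ennreal_mult) (simp_all add: mult.assoc)
    also have "2 powr (real k * P) * (flip_const e / 2 ^ k) = flip_const e * 2 powr (real k * (P - 1))"
      by (simp add: right_diff_distrib powr_diff powr_realpow)
    also have "ennreal (flip_const e * 2 powr (real k * (P - 1))) * (\<integral>\<^sup>+x. ennreal (g x) * indicator {x. 2 ^ k < g x} x \<partial>unit_leb)
      = ennreal (flip_const e) * (\<integral>\<^sup>+x. ennreal (2 powr (real k * (P - 1))) * (ennreal (g x) * indicator {x. 2 ^ k < g x} x) \<partial>unit_leb)"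
      using flip_const_nonneg[OF e] by (subst nn_integral_cmult) (auto simp: ennreal_mult mult.assoc)
    also have "(\<integral>\<^sup>+x. ennreal (2 powr (real k * (P - 1))) * (ennreal (g x) * indicator {x. 2 ^ k < g x} x) \<partial>unit_leb)
      = (\<integral>\<^sup>+x. ennreal (g x * (if 2 ^ k < g x then 2 powr (real k * (P - 1)) else 0)) \<partial>unit_leb)"
      using g0 by (intro nn_integral_cong) (auto simp: indicator_def ennreal_mult mult.commute)
    finally show ?thesis .
  qed
  have "(\<integral>\<^sup>+x. ennreal_powr (max 1 (?W x)) P \<partial>unit_leb)
    \<le> (\<integral>\<^sup>+x. ennreal (4 powr P) * (1 + (\<Sum>k. ?L k x)) \<partial>unit_leb)"
    using P by (intro nn_integral_mono ennreal_powr_layers) simp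
  also have "\<dots> = ennreal (4 powr P) * ((\<integral>\<^sup>+x. 1 \<partial>unit_leb) + (\<integral>\<^sup>+x. (\<Sum>k. ?L k x) \<partial>unit_leb))"
    by (subst nn_integral_cmult, measurable) (subst nn_integral_add, auto)
  also have "(\<integral>\<^sup>+x. 1 \<partial>unit_leb) = 1"
    using emeasure_dyadic_interval[of 0 0] by (simp add: dyadic_interval_def)
  also have "(\<integral>\<^sup>+x. (\<Sum>k. ?L k x) \<partial>unit_leb) = (\<Sum>k. \<integral>\<^sup>+x. ?L k x \<partial>unit_leb)"
    by (rule nn_integral_suminf) measurable
  also have "(\<Sum>k. \<integral>\<^sup>+x. ?L k x \<partial>unit_leb)
    \<le> (\<Sum>k. ennreal (flip_const e) * (\<integral>\<^sup>+x. ennreal (g x * (if 2 ^ k < g x then 2 powr (real k * (P - 1)) else 0)) \<partial>unit_leb))"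
    by (intro suminf_le layer) auto
  also have "\<dots> = ennreal (flip_const e) * (\<integral>\<^sup>+x. (\<Sum>k. ennreal (g x * (if 2 ^ k < g x then 2 powr (real k * (P - 1)) else 0))) \<partial>unit_leb)"
    by (subst nn_integral_suminf) auto
  also have "\<dots> \<le> ennreal (flip_const e) * (\<integral>\<^sup>+x. ennreal c * ennreal (g x powr P) \<partial>unit_leb)"
  proof (intro mult_left_mono nn_integral_mono)
    fix x
    have "(\<Sum>k. ennreal (g x * (if 2 ^ k < g x then 2 powr (real k * (P - 1)) else 0)))
      = ennreal (g x) * (\<Sum>k. ennreal (if 2 ^ k < g x then 2 powr (real k * (P - 1)) else 0))"
      using g0 by (subst ennreal_suminf_cmult[symmetric]) (auto simp: ennreal_mult)
    also have "\<dots> \<le> ennreal (g x) * ennreal (c * g x powr (P - 1))"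
      unfolding c_def using P g0 by (intro mult_left_mono suminf_powr_below) auto
    also have "\<dots> = ennreal (c * (g x * g x powr (P - 1)))"
      using g0 c by (simp add: ennreal_mult mult.left_commute)
    also have "g x * g x powr (P - 1) = g x powr P"
      using g0[of x] by (cases "g x = 0") (auto simp: powr_diff)
    also have "ennreal (c * g x powr P) = ennreal c * ennreal (g x powr P)"
      using c by (simp add: ennreal_mult)
    finally show "(\<Sum>k. ennreal (g x * (if 2 ^ k < g x then 2 powr (real k * (P - 1)) else 0))) \<le> ennreal c * ennreal (g x powr P)" .
  qed auto
  also have "\<dots> = ennreal (flip_const e * c) * (\<integral>\<^sup>+x. ennreal (g x powr P) \<partial>unit_leb)"
    using c flip_const_nonneg[OF e] by (subst nn_integral_cmult) (auto simp: ennreal_mult mult.assoc)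
  finally show ?thesis
    by (simp add: c_def mult_left_mono add_left_mono)
qed

section \<open>The variable exponent on dyadic intervals\<close>

text \<open>
  The supremum that defines \<open>essinf\<close> can be taken along a sequence of its elements, hence outside a
  single null set.
\<close>

lemma essinf_AE: "AE x in M. essinf M f \<le> f x"
proof -
  let ?S = "{z. AE x in M. z \<le> f x}"
  have "- \<infinity> \<in> ?S" by simp
  then have "?S \<noteq> {}" by blast
  then obtain z :: "nat \<Rightarrow> ereal" where z: "range z \<subseteq> ?S" "Sup ?S = (SUP i. z i)"
    using Sup_countable_SUP by metis
  have "AE x in M. \<forall>i. z i \<le> f x"
    using z(1) by (subst AE_all_countable) auto
  then show ?thesis
    unfolding essinf_def z(2) by eventually_elim (auto intro: SUP_least)
qed

text \<open>
  The hypotheses on \<open>p\<close> in the form in which they are used. Since there are only countably many dyadic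
  intervals, a single null set serves for all of them. The last conjunct is the regularity
  hypothesis with \<open>p x\<close> in place of the essential supremum.
\<close>

lemma dyadic_exponent_bounds:
  fixes p :: "real \<Rightarrow> real"
  assumes meas: "p \<in> borel_measurable unit_leb"
    and P: "p_minus p {0..<1} = ereal P" and Q: "p_plus p {0..<1} = ereal Q"
    and K: "\<And>n k. k < 2 ^ n \<Longrightarrow>
           measure unit_leb (dyadic_interval n k) powr
             real_of_ereal (p_minus p (dyadic_interval n k) - p_plus p (dyadic_interval n k)) \<le> K"
  shows "AE x in unit_leb. \<forall>n.
    P \<le> real_of_ereal (p_minus p (dyadic_interval n (dyadic_index n x))) \<and>
    real_of_ereal (p_minus p (dyadic_interval n (dyadic_index n x))) \<le> p x \<and> p x \<le> Q \<and>
    2 powr (real n * (p x - real_of_ereal (p_minus p (dyadic_interval n (dyadic_index n x))))) \<le> K"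
proof -
  let ?I = dyadic_interval
  have AE_leb: "(AE x in unit_leb. R x) \<longleftrightarrow> (AE x in lebesgue. x \<in> {0..<1} \<longrightarrow> R x)" for R
    by (rule AE_restrict_space_iff) simp
  have AE_P: "AE x in unit_leb. ereal P \<le> ereal (p x)"
    using essinf_AE[of unit_leb "\<lambda>x. ereal (p x)"] P by (simp add: p_minus_def)
  have AE_Q: "AE x in unit_leb. ereal (p x) \<le> ereal Q"
    using esssup_AE[of "\<lambda>x. ereal (p x)" unit_leb] Q by (simp add: p_plus_def)
  have dyadic: "ereal P \<le> p_minus p (?I n k) \<and> p_plus p (?I n k) \<le> ereal Q \<and>
     (AE x in unit_leb. x \<in> ?I n k \<longrightarrow> p_minus p (?I n k) \<le> ereal (p x) \<and> ereal (p x) \<le> p_plus p (?I n k))"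
    if k: "k < 2 ^ n" for n k
  proof -
    note sub = dyadic_interval_subset_unit[OF k]
    have AE_I: "(AE x in lebesgue_on (?I n k). R x) \<longleftrightarrow> (AE x in lebesgue. x \<in> ?I n k \<longrightarrow> R x)" for R
      by (rule AE_restrict_space_iff) (simp add: dyadic_interval_def)
    have to_I: "AE x in lebesgue_on (?I n k). R x" if "AE x in unit_leb. R x" for R
      using that sub unfolding AE_I AE_leb by (auto elim!: eventually_mono)
    have of_I: "AE x in unit_leb. x \<in> ?I n k \<longrightarrow> R x" if "AE x in lebesgue_on (?I n k). R x" for R
      using that unfolding AE_I AE_leb by (auto elim!: eventually_mono)
    have meas_I: "(\<lambda>x. ereal (p x)) \<in> borel_measurable (lebesgue_on (?I n k))"
      using measurable_restrict_mono[OF meas sub] by measurable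
    have "ereal P \<le> p_minus p (?I n k)"
      unfolding p_minus_def essinf_def by (rule Sup_upper) (simp only: mem_Collect_eq to_I[OF AE_P])
    moreover have "p_plus p (?I n k) \<le> ereal Q"
      unfolding p_plus_def by (rule esssup_I[OF meas_I to_I[OF AE_Q]])
    moreover have "AE x in unit_leb. x \<in> ?I n k \<longrightarrow> p_minus p (?I n k) \<le> ereal (p x)"
      unfolding p_minus_def by (rule of_I[OF essinf_AE])
    moreover have "AE x in unit_leb. x \<in> ?I n k \<longrightarrow> ereal (p x) \<le> p_plus p (?I n k)"
      unfolding p_plus_def by (rule of_I[OF esssup_AE])
    ultimately show ?thesis
      by (auto elim: eventually_elim2)
  qed
  have "AE x in unit_leb. \<forall>n k. k < 2 ^ n \<longrightarrow> x \<in> ?I n k \<longrightarrow>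
      p_minus p (?I n k) \<le> ereal (p x) \<and> ereal (p x) \<le> p_plus p (?I n k)"
    using dyadic by (auto simp: AE_all_countable)
  moreover have "AE x in unit_leb. x \<in> {0..<1}"
    using AE_space[of unit_leb] by simp
  ultimately show ?thesis
  proof eventually_elim
    case (elim x)
    show ?case
    proof
      fix n
      define k where "k = dyadic_index n x"
      have k: "k < 2 ^ n" and x: "x \<in> ?I n k"
        using elim(2) by (auto simp: k_def dyadic_index_less dyadic_index_unique)
      have le: "p_minus p (?I n k) \<le> ereal (p x)" "ereal (p x) \<le> p_plus p (?I n k)"
        using elim(1) k x by auto
      obtain a where a: "p_minus p (?I n k) = ereal a"
        using le(1) dyadic[OF k] by (cases "p_minus p (?I n k)") auto
      obtain b where b: "p_plus p (?I n k) = ereal b"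
        using le(2) dyadic[OF k] by (cases "p_plus p (?I n k)") auto
      have ab: "P \<le> a" "a \<le> p x" "p x \<le> b" "b \<le> Q"
        using le dyadic[OF k] a b by auto
      have "2 powr (real n * (p x - a)) \<le> 2 powr (real n * (b - a))"
        using ab by (intro powr_mono mult_left_mono) auto
      also have "\<dots> = (1 / 2 ^ n) powr (a - b)"
        by (simp add: powr_divide powr_powr powr_minus_divide[symmetric] algebra_simps flip: powr_realpow)
      also have "\<dots> \<le> K"
        using K[OF k] by (simp add: measure_dyadic_interval[OF k] a b)
      finally show "P \<le> real_of_ereal (p_minus p (?I n (dyadic_index n x))) \<and>
          real_of_ereal (p_minus p (?I n (dyadic_index n x))) \<le> p x \<and> p x \<le> Q \<and>
          2 powr (real n * (p x - real_of_ereal (p_minus p (?I n (dyadic_index n x))))) \<le> K"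
        using ab by (simp add: a k_def[symmetric])
    qed
  qed
qed

text \<open>
  The graph of \<open>y \<mapsto> y powr r\<close> lies above its tangent at \<open>c\<close>.
\<close>

lemma powr_tangent:
  fixes y c r :: real
  assumes "0 \<le> y" "0 < c" "1 \<le> r"
  shows "y \<le> c powr (1 - r) / r * y powr r + (1 - 1 / r) * c"
proof (cases "y = 0")
  case True
  then show ?thesis using assms by simp
next
  case False
  then have y: "0 < y" using assms by simp
  have "(y powr r) powr (1 / r) * (c powr r) powr (1 - 1 / r) \<le> 1 / r * y powr r + (1 - 1 / r) * c powr r"
    using assms y by (intro Youngs_inequality_0) auto
  also have "(y powr r) powr (1 / r) * (c powr r) powr (1 - 1 / r) = y * c powr (r - 1)"
    using assms y by (simp add: powr_powr right_diff_distrib)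
  finally have "c powr (1 - r) * (y * c powr (r - 1)) \<le> c powr (1 - r) * (1 / r * y powr r + (1 - 1 / r) * c powr r)"
    by (rule mult_left_mono) simp
  moreover have "c powr (1 - r) * c powr (r - 1) = 1" "c powr (1 - r) * c powr r = c"
    using assms by (simp_all add: powr_add[symmetric])
  ultimately show ?thesis
    by (simp add: distrib_left mult.left_commute)
qed

lemma dyadic_avg_mono_AE:
  assumes "AE x in unit_leb. x \<in> dyadic_interval n k \<longrightarrow> f x \<le> g x"
  shows "dyadic_avg f n k \<le> dyadic_avg g n k"
  unfolding dyadic_avg_def using assms
  by (intro mult_left_mono nn_integral_mono_AE) (auto elim!: eventually_mono simp: indicator_def)

lemma dyadic_avg_affine:
  assumes [measurable]: "h \<in> borel_measurable unit_leb" and k: "k < 2 ^ n"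
  shows "dyadic_avg (\<lambda>x. a * h x + b) n k = a * dyadic_avg h n k + b"
proof -
  note [measurable] = dyadic_interval_sets[OF k]
  have "(\<integral>\<^sup>+x\<in>dyadic_interval n k. a * h x + b \<partial>unit_leb)
    = (\<integral>\<^sup>+x. a * (h x * indicator (dyadic_interval n k) x) + b * indicator (dyadic_interval n k) x \<partial>unit_leb)"
    by (intro nn_integral_cong) (auto simp: indicator_def)
  also have "\<dots> = a * (\<integral>\<^sup>+x\<in>dyadic_interval n k. h x \<partial>unit_leb) + b * ennreal (1 / 2 ^ n)"
    by (subst nn_integral_add) (auto simp: nn_integral_cmult emeasure_dyadic_interval[OF k])
  also have "ennreal (2 ^ n) * \<dots> = a * (ennreal (2 ^ n) * (\<integral>\<^sup>+x\<in>dyadic_interval n k. h x \<partial>unit_leb))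
      + b * (ennreal (2 ^ n) * ennreal (1 / 2 ^ n))"
    by (simp only: distrib_left mult.left_commute)
  also have "ennreal (2 ^ n) * ennreal (1 / 2 ^ n) = 1"
    by (subst ennreal_mult[symmetric]) auto
  finally show ?thesis
    by (simp add: dyadic_avg_def)
qed

text \<open>
  Jensen's inequality for the power \<open>r\<close>, with a bound \<open>c > 0\<close> instead of the average itself: the
  tangent at \<open>c\<close> can then be used without a case distinction for vanishing averages.
\<close>

lemma dyadic_avg_jensen:
  fixes u :: "real \<Rightarrow> real"
  assumes [measurable]: "u \<in> borel_measurable unit_leb" and u: "\<And>x. 0 \<le> u x"
    and k: "k < 2 ^ n" and r: "1 \<le> r" and c: "0 < c"
    and le: "dyadic_avg (\<lambda>x. u x powr r) n k \<le> ennreal (c powr r)"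
  shows "dyadic_avg u n k \<le> ennreal c"
proof -
  define a where "a = c powr (1 - r) / r"
  define b where "b = (1 - 1 / r) * c"
  have a: "0 \<le> a" and b: "0 \<le> b" using r c by (auto simp: a_def b_def)
  have "dyadic_avg u n k \<le> dyadic_avg (\<lambda>x. ennreal a * ennreal (u x powr r) + ennreal b) n k"
  proof (intro dyadic_avg_mono_AE AE_I2 impI)
    fix x
    have "ennreal (u x) \<le> ennreal (a * u x powr r + b)"
      unfolding a_def b_def by (rule ennreal_leI[OF powr_tangent[OF u c r]])
    also have "\<dots> = ennreal a * ennreal (u x powr r) + ennreal b"
      using a b by (simp add: ennreal_mult)
    finally show "ennreal (u x) \<le> ennreal a * ennreal (u x powr r) + ennreal b" .
  qed
  also have "\<dots> = ennreal a * dyadic_avg (\<lambda>x. u x powr r) n k + ennreal b"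
    using k by (intro dyadic_avg_affine) measurable
  also have "\<dots> \<le> ennreal a * ennreal (c powr r) + ennreal b"
    by (intro add_right_mono mult_left_mono le) simp
  also have "\<dots> = ennreal (a * c powr r + b)"
    using a b by (simp add: ennreal_mult)
  also have "a * c powr r + b = c"
  proof -
    have "c powr (1 - r) * c powr r = c" using c by (simp add: powr_add[symmetric])
    then have "a * c powr r = c / r" by (simp add: a_def)
    then show ?thesis using r by (simp add: b_def field_simps)
  qed
  finally show ?thesis .
qed

text \<open>
  The change of exponent, where \<open>1 / P - 1 / Q\<close> is weighed against \<open>s\<close>. In the application \<open>t = p x\<close>, \<open>q\<close> is the
  lower bound of \<open>p\<close> on the level \<open>j\<close> interval around \<open>x\<close>, \<open>j + m\<close> is the level of the shifted
  interval, and \<open>\<beta>\<close> bounds the average of \<open>g\<close> over it.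
\<close>

lemma exponent_gain:
  fixes P Q K s q t w \<beta> :: real
  assumes P: "1 < P" and q: "P \<le> q" "q \<le> t" "t \<le> Q" and K: "2 powr (real j * (t - q)) \<le> K"
    and d: "d = s - (1 / P - 1 / Q)" "0 < d" and w: "1 \<le> w"
    and \<beta>: "0 < \<beta>" "\<beta> \<le> 2 powr (d / 2 * real m) * w" "\<beta> \<le> 2 powr (real (j + m) / P)"
  shows "2 powr (- (real m * s)) * \<beta> powr (P / q) \<le> K * 2 powr (- (d / 2 * real m)) * w powr (P / t)"
proof -
  define g where "g = 1 / q - 1 / t"
  have g0: "0 \<le> g" using P q by (simp add: g_def field_simps)
  have gs: "g \<le> s - d"
  proof -
    have "1 / q \<le> 1 / P" "1 / Q \<le> 1 / t" using P q by (auto intro!: divide_left_mono mult_pos_pos)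
    then show ?thesis using d by (simp add: g_def)
  qed
  have "\<beta> powr (P / q) = \<beta> powr (P / t) * \<beta> powr (P * g)"
    by (simp add: g_def powr_add[symmetric] algebra_simps)
  also have "\<dots> \<le> (2 powr (d / 2 * real m) * w powr (P / t)) * (2 powr (real m * (s - d)) * K)"
  proof (rule mult_mono)
    have "\<beta> powr (P / t) \<le> (2 powr (d / 2 * real m) * w) powr (P / t)"
      using \<beta> P q by (intro powr_mono2) auto
    also have "\<dots> = (2 powr (d / 2 * real m)) powr (P / t) * w powr (P / t)"
      using w by (simp add: powr_mult)
    also have "\<dots> \<le> (2 powr (d / 2 * real m)) powr 1 * w powr (P / t)"
      using P q d by (intro mult_right_mono powr_mono) (auto intro: ge_one_powr_ge_zero)
    finally show "\<beta> powr (P / t) \<le> 2 powr (d / 2 * real m) * w powr (P / t)"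
      by simp
    have "\<beta> powr (P * g) \<le> (2 powr (real (j + m) / P)) powr (P * g)"
      using \<beta> P g0 by (intro powr_mono2) auto
    also have "\<dots> = 2 powr (real (j + m) / P * (P * g))"
      by (rule powr_powr)
    also have "real (j + m) / P * (P * g) = real m * g + real j * g"
      using P by (simp add: field_simps)
    also have "2 powr (real m * g + real j * g) = 2 powr (real m * g) * 2 powr (real j * g)"
      by (rule powr_add)
    also have "\<dots> \<le> 2 powr (real m * (s - d)) * K"
    proof (rule mult_mono)
      show "2 powr (real m * g) \<le> 2 powr (real m * (s - d))"
        using gs by (intro powr_mono mult_left_mono) auto
      have "1 * 1 \<le> q * t" using P q by (intro mult_mono) auto
      then have "g \<le> t - q"
        using P q mult_left_mono[of 1 "q * t" "t - q"] by (simp add: g_def field_simps)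
      then have "2 powr (real j * g) \<le> 2 powr (real j * (t - q))"
        by (intro powr_mono mult_left_mono) auto
      then show "2 powr (real j * g) \<le> K" using K by (rule order_trans)
    qed auto
    finally show "\<beta> powr (P * g) \<le> 2 powr (real m * (s - d)) * K" .
  qed auto
  finally have "2 powr (- (real m * s)) * \<beta> powr (P / q)
    \<le> 2 powr (- (real m * s)) * ((2 powr (d / 2 * real m) * w powr (P / t)) * (2 powr (real m * (s - d)) * K))"
    by (rule mult_left_mono) simp
  also have "\<dots> = K * (2 powr (- (real m * s)) * 2 powr (d / 2 * real m) * 2 powr (real m * (s - d))) * w powr (P / t)"
    by simp
  also have "2 powr (- (real m * s)) * 2 powr (d / 2 * real m) * 2 powr (real m * (s - d)) = 2 powr (- (d / 2 * real m))"
    by (simp add: powr_add[symmetric] algebra_simps)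
  finally show ?thesis .
qed

section \<open>Domination of the maximal operator and the norm inequality\<close>

text \<open>
  No integrability of \<open>f\<close> is needed, because the Bochner integral of a non-integrable function is \<open>0\<close>.
\<close>

lemma average_le_dyadic_avg:
  assumes "k < 2 ^ n"
  shows "ennreal (1 / measure unit_leb (dyadic_interval n k) * \<bar>LINT y:dyadic_interval n k|unit_leb. f y\<bar>)
    \<le> dyadic_avg (\<lambda>x. ennreal \<bar>f x\<bar>) n k"
proof -
  let ?F = "\<lambda>y. indicator (dyadic_interval n k) y *\<^sub>R f y"
  have "ennreal \<bar>\<integral>y. ?F y \<partial>unit_leb\<bar> \<le> (\<integral>\<^sup>+y. ennreal (norm (?F y)) \<partial>unit_leb)"
  proof (cases "integrable unit_leb ?F")
    case True
    then show ?thesis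
      using integral_norm_bound_ennreal[OF True] by simp
  next
    case False
    then show ?thesis by (simp add: not_integrable_integral_eq)
  qed
  also have "\<dots> = (\<integral>\<^sup>+y\<in>dyadic_interval n k. ennreal \<bar>f y\<bar> \<partial>unit_leb)"
    by (intro nn_integral_cong) (auto simp: indicator_def)
  finally have "ennreal (2 ^ n) * ennreal \<bar>\<integral>y. ?F y \<partial>unit_leb\<bar>
    \<le> dyadic_avg (\<lambda>x. ennreal \<bar>f x\<bar>) n k"
    unfolding dyadic_avg_def by (rule mult_left_mono) simp
  then show ?thesis
    by (simp add: measure_dyadic_interval[OF assms] set_lebesgue_integral_def ennreal_mult)
qed

lemma sum_geometric_tail:
  fixes c :: real
  assumes "0 < c"
  shows "(\<Sum>j<n. 2 powr (- (c * real (n - j)))) \<le> 1 / (1 - 2 powr (- c))"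
proof -
  define z where "z = 2 powr (- c)"
  have z: "0 < z" "z < 1"
    using assms powr_less_mono[of "-c" 0 2] by (auto simp: z_def)
  have "(\<Sum>j<n. 2 powr (- (c * real (n - j)))) = (\<Sum>j<n. z ^ Suc (n - Suc j))"
  proof (intro sum.cong refl)
    fix j assume "j \<in> {..<n}"
    then have "Suc (n - Suc j) = n - j" by auto
    then show "2 powr (- (c * real (n - j))) = z ^ Suc (n - Suc j)"
      by (simp only: z_def powr_power) (simp add: mult.commute)
  qed
  also have "\<dots> = (\<Sum>j<n. z ^ Suc j)"
    by (rule sum.nat_diff_reindex)
  also have "\<dots> \<le> (\<Sum>j<n. z ^ j)"
    using z by (intro sum_mono) (simp add: mult_left_le_one_le)
  also have "\<dots> = (1 - z ^ n) / (1 - z)"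
    using z by (simp add: sum_gp_strict)
  also have "\<dots> \<le> 1 / (1 - z)"
    using z by (intro divide_right_mono) auto
  finally show ?thesis by (simp add: z_def)
qed

text \<open>
  The pointwise domination. The function \<open>lo\<close> stands for the essential infimum of \<open>p\<close> on the dyadic
  intervals. The bound is stated for all real \<open>w \<ge> 1\<close> above the maximal function, which says nothing
  at points where the latter is infinite.
\<close>

lemma U_max_le_flip_max:
  fixes p f :: "real \<Rightarrow> real" and lo :: "nat \<Rightarrow> nat \<Rightarrow> real"
  assumes p [measurable]: "p \<in> borel_measurable unit_leb"
    and f [measurable]: "f \<in> borel_measurable unit_leb"
    and bounds: "AE x in unit_leb. \<forall>n. P \<le> lo n (dyadic_index n x) \<and> lo n (dyadic_index n x) \<le> p x
      \<and> p x \<le> Q \<and> 2 powr (real n * (p x - lo n (dyadic_index n x))) \<le> K"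
    and P: "1 < P" and d: "d = s - (1 / P - 1 / Q)" "0 < d"
    and modular: "(\<integral>\<^sup>+x. ennreal (\<bar>f x\<bar> powr p x) \<partial>unit_leb) \<le> 1"
    and g: "g = (\<lambda>x. (if 1 < \<bar>f x\<bar> then \<bar>f x\<bar> else 0) powr (p x / P))"
  shows "AE x in unit_leb. \<forall>w. 1 \<le> w \<longrightarrow> flip_max (d / 2) g x \<le> ennreal w \<longrightarrow>
    U_max s f x \<le> ennreal ((1 + K) / (1 - 2 powr (- (d / 2))) * w powr (P / p x))"
proof -
  define u where "u x = (if 1 < \<bar>f x\<bar> then \<bar>f x\<bar> else 0)" for x
  have [measurable]: "u \<in> borel_measurable unit_leb"
    unfolding u_def by measurable
  have g_eq: "g = (\<lambda>x. u x powr (p x / P))"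
    by (simp add: g u_def)
  have [measurable]: "g \<in> borel_measurable unit_leb"
    unfolding g_eq by measurable
  have u0: "0 \<le> u x" and g0: "0 \<le> g x" for x
    by (auto simp: u_def g_eq)
  have gP: "g x powr P = u x powr p x" for x
    using P by (simp add: g_eq powr_powr)
  have avg_g: "dyadic_avg g n k \<le> ennreal (2 powr (real n / P))" if k: "k < 2 ^ n" for n k
  proof (rule dyadic_avg_jensen[OF _ g0 k, where r = P])
    have "(\<integral>\<^sup>+x\<in>dyadic_interval n k. ennreal (g x powr P) \<partial>unit_leb)
      \<le> (\<integral>\<^sup>+x. ennreal (\<bar>f x\<bar> powr p x) \<partial>unit_leb)"
      by (intro nn_integral_mono) (auto simp: indicator_def gP u_def)
    then have "(\<integral>\<^sup>+x\<in>dyadic_interval n k. ennreal (g x powr P) \<partial>unit_leb) \<le> 1"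
      using modular by (rule order_trans)
    then have "dyadic_avg (\<lambda>x. g x powr P) n k \<le> ennreal (2 ^ n) * 1"
      unfolding dyadic_avg_def by (rule mult_left_mono) simp
    also have "\<dots> = ennreal ((2 powr (real n / P)) powr P)"
      using P by (simp add: powr_powr powr_realpow)
    finally show "dyadic_avg (\<lambda>x. g x powr P) n k \<le> ennreal ((2 powr (real n / P)) powr P)" .
  qed (use P in auto)
  have avg_u: "dyadic_avg u n k \<le> ennreal (\<beta> powr (P / q))"
    if k: "k < 2 ^ n" and j: "j \<le> n" and q: "q = lo j (drop_bit (n - j) k)" "P \<le> q"
      and \<beta>: "0 < \<beta>" "dyadic_avg g n k \<le> ennreal \<beta>" for n k j q \<beta>
  proof (rule dyadic_avg_jensen[OF _ u0 k, where r = "q / P"])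
    have "dyadic_avg (\<lambda>x. u x powr (q / P)) n k \<le> dyadic_avg g n k"
    proof (rule dyadic_avg_mono_AE)
      show "AE x in unit_leb. x \<in> dyadic_interval n k \<longrightarrow> ennreal (u x powr (q / P)) \<le> ennreal (g x)"
        using bounds AE_space
      proof eventually_elim
        case (elim x)
        show ?case
        proof
          assume x: "x \<in> dyadic_interval n k"
          have x0: "0 \<le> x" using elim(2) by simp
          have "dyadic_index n x = k" using x dyadic_index_unique[OF x0] by simp
          then have "drop_bit (n - j) k = dyadic_index j x"
            using drop_bit_dyadic_index[of "n - j" n x] x0 j by simp
          then have "q \<le> p x" using elim(1) q by auto
          then have "q / P \<le> p x / P" using P by (simp add: divide_right_mono)
          \<comment> \<open>Each value of \<open>u\<close> is \<open>0\<close> or larger than \<open>1\<close>, so a larger exponent gives a larger power.\<close>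
          then have "u x powr (q / P) \<le> g x"
            unfolding g_eq by (auto simp: u_def intro!: powr_mono)
          then show "ennreal (u x powr (q / P)) \<le> ennreal (g x)" by (rule ennreal_leI)
        qed
      qed
    qed
    also have "\<dots> \<le> ennreal \<beta>" by (rule \<beta>)
    also have "\<beta> = (\<beta> powr (P / q)) powr (q / P)"
      using P q \<beta> by (simp add: powr_powr)
    finally show "dyadic_avg (\<lambda>x. u x powr (q / P)) n k \<le> ennreal ((\<beta> powr (P / q)) powr (q / P))" .
  qed (use P q \<beta> in auto)
  have avg_f: "dyadic_avg (\<lambda>x. \<bar>f x\<bar>) n k \<le> 1 + dyadic_avg u n k" if k: "k < 2 ^ n" for n k
  proof -
    have "dyadic_avg (\<lambda>x. \<bar>f x\<bar>) n k \<le> dyadic_avg (\<lambda>x. 1 * ennreal (u x) + 1) n k"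
    proof (intro dyadic_avg_mono_AE AE_I2 impI)
      fix x
      have "ennreal \<bar>f x\<bar> \<le> ennreal (u x + 1)"
        by (intro ennreal_leI) (auto simp: u_def)
      then show "ennreal \<bar>f x\<bar> \<le> 1 * ennreal (u x) + 1"
        using u0 by simp
    qed
    also have "\<dots> = 1 * dyadic_avg u n k + 1"
      using k by (intro dyadic_avg_affine) measurable
    finally show ?thesis by (simp add: add.commute)
  qed
  show ?thesis
    using bounds AE_space
  proof eventually_elim
    case (elim x)
    then have x: "x \<in> {0..<1}" by simp
    define t where "t = p x"
    have K1: "0 < K" using elim(1)[rule_format, of 0] by (simp split: if_splits)
    have PQ: "P \<le> t" "t \<le> Q" using elim(1)[rule_format, of 0] by (auto simp: t_def)
    have "1 / Q \<le> 1 / P" using P PQ by (intro divide_left_mono) auto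
    then have ds: "d / 2 \<le> s" using d by linarith
    show ?case
    proof (intro allI impI)
      fix w :: real assume w: "1 \<le> w" and flip: "flip_max (d / 2) g x \<le> ennreal w"
      have wp: "1 \<le> w powr (P / t)"
        using w P PQ by (intro ge_one_powr_ge_zero) auto
      have summand: "2 powr ((real j - real n) * s)
          * (1 / measure unit_leb (dyadic_shift (dyadic_interval n k) j))
          * \<bar>LINT y:dyadic_shift (dyadic_interval n k) j|unit_leb. f y\<bar>
        \<le> (1 + K) * w powr (P / t) * 2 powr (- (d / 2 * real (n - j)))"
        if k: "k = dyadic_index n x" and j: "j < n" for n k j
      proof -
        define m where "m = n - j"
        define k' where "k' = flip_bit (n - 1 - j) k"
        define q where "q = lo j (dyadic_index j x)"
        have k2: "k < 2 ^ n" using dyadic_index_less[OF x] k by simp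
        have k': "k' < 2 ^ n" unfolding k'_def using k2 j by (intro flip_bit_less) auto
        have q: "P \<le> q" "q \<le> t" "2 powr (real j * (t - q)) \<le> K"
          using elim(1) by (auto simp: q_def t_def)
        have "\<not> n - j \<le> n - 1 - j" using j by simp
        then have "drop_bit (n - j) k' = dyadic_index j x"
          using j x drop_bit_dyadic_index[of "n - j" n x] by (simp add: k'_def drop_bit_flip_bit_nat k)
        then have q_eq: "q = lo j (drop_bit (n - j) k')" by (simp add: q_def)
        \<comment> \<open>Both bounds are needed: the first brings in \<open>w\<close>, the second controls the change of exponent.\<close>
        define \<beta> where "\<beta> = min (2 powr (d / 2 * real m) * w) (2 powr (real n / P))"
        have \<beta>0: "0 < \<beta>" using w by (simp add: \<beta>_def)
        have "ennreal (2 powr (- (d / 2) * real (n - 1 - j + 1))) * dyadic_avg g n k' \<le> flip_max (d / 2) g x"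
          unfolding flip_max_def k'_def k using j
          by (intro SUP_upper2[of "(n, n - 1 - j)"]) auto
        also have "n - 1 - j + 1 = m" using j by (simp add: m_def)
        finally have "ennreal (2 powr (- (d / 2) * real m)) * dyadic_avg g n k' \<le> ennreal w"
          using flip by (rule order_trans)
        then have "ennreal (2 powr (d / 2 * real m)) * (ennreal (2 powr (- (d / 2) * real m)) * dyadic_avg g n k')
          \<le> ennreal (2 powr (d / 2 * real m)) * ennreal w"
          by (rule mult_left_mono) simp
        moreover have "ennreal (2 powr (d / 2 * real m)) * ennreal (2 powr (- (d / 2) * real m)) = 1"
          by (subst ennreal_mult[symmetric]) (auto simp: powr_add[symmetric])
        ultimately have "dyadic_avg g n k' \<le> ennreal (2 powr (d / 2 * real m) * w)"
          using w by (simp add: mult.assoc[symmetric] ennreal_mult)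
        with avg_g[OF k'] have "dyadic_avg g n k' \<le> ennreal \<beta>"
          by (simp add: \<beta>_def min_def)
        from avg_u[OF k' less_imp_le[OF j] q_eq q(1) \<beta>0 this]
        have "dyadic_avg (\<lambda>x. \<bar>f x\<bar>) n k' \<le> 1 + ennreal (\<beta> powr (P / q))"
          using avg_f[OF k'] by (meson add_left_mono order_trans)
        also have "\<dots> = ennreal (1 + \<beta> powr (P / q))" by simp
        finally have "ennreal (1 / measure unit_leb (dyadic_interval n k') * \<bar>LINT y:dyadic_interval n k'|unit_leb. f y\<bar>)
          \<le> ennreal (1 + \<beta> powr (P / q))"
          by (rule order_trans[OF average_le_dyadic_avg[OF k']])
        then have av: "1 / measure unit_leb (dyadic_interval n k') * \<bar>LINT y:dyadic_interval n k'|unit_leb. f y\<bar>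
          \<le> 1 + \<beta> powr (P / q)"
          by (simp add: add_nonneg_nonneg ennreal_le_iff del: ennreal_plus)
        have gain: "2 powr (- (real m * s)) * \<beta> powr (P / q) \<le> K * 2 powr (- (d / 2 * real m)) * w powr (P / t)"
          using j by (intro exponent_gain[OF P q(1,2) PQ(2) q(3) d w \<beta>0]) (auto simp: \<beta>_def m_def)
        have exponent_eq: "(real j - real n) * s = - (real m * s)"
          using j by (simp add: m_def of_nat_diff algebra_simps)
        have "2 powr (- (real m * s)) * (1 / measure unit_leb (dyadic_interval n k') * \<bar>LINT y:dyadic_interval n k'|unit_leb. f y\<bar>)
          \<le> 2 powr (- (real m * s)) * (1 + \<beta> powr (P / q))"
          using av by (rule mult_left_mono) simp
        moreover have "2 powr (- (real m * s)) \<le> 2 powr (- (d / 2 * real m)) * w powr (P / t)"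
        proof -
          have "2 powr (- (real m * s)) \<le> 2 powr (- (d / 2 * real m)) * 1"
            using mult_right_mono[OF ds, of "real m"] by (simp add: mult.commute)
          also have "\<dots> \<le> 2 powr (- (d / 2 * real m)) * w powr (P / t)"
            using wp by (intro mult_left_mono) auto
          finally show ?thesis .
        qed
        ultimately show ?thesis
          using gain
          unfolding dyadic_shift_dyadic_interval[OF k2 j] k'_def[symmetric] m_def[symmetric] exponent_eq
          by (simp add: algebra_simps)
      qed
      show "U_max s f x \<le> ennreal ((1 + K) / (1 - 2 powr (- (d / 2))) * w powr (P / p x))"
        unfolding U_max_def
      proof (rule SUP_least, clarify)
        fix n k assume k: "k < (2::nat) ^ n" "x \<in> dyadic_interval n k"
        have keq: "k = dyadic_index n x" using k x dyadic_index_unique by simp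
        have "(\<Sum>j<n. 2 powr ((real j - real n) * s)
          * (1 / measure unit_leb (dyadic_shift (dyadic_interval n k) j))
          * \<bar>LINT y:dyadic_shift (dyadic_interval n k) j|unit_leb. f y\<bar>)
          \<le> (\<Sum>j<n. (1 + K) * w powr (P / t) * 2 powr (- (d / 2 * real (n - j))))"
          by (intro sum_mono summand keq) auto
        also have "\<dots> = (1 + K) * w powr (P / t) * (\<Sum>j<n. 2 powr (- (d / 2 * real (n - j))))"
          by (rule sum_distrib_left[symmetric])
        also have "\<dots> \<le> (1 + K) * w powr (P / t) * (1 / (1 - 2 powr (- (d / 2))))"
          using K1 d by (intro mult_left_mono sum_geometric_tail) auto
        also have "\<dots> = (1 + K) / (1 - 2 powr (- (d / 2))) * w powr (P / p x)"
          by (simp add: t_def)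
        finally show "ennreal (\<Sum>j<n. 2 powr ((real j - real n) * s)
          * (1 / measure unit_leb (dyadic_shift (dyadic_interval n k) j))
          * \<bar>LINT y:dyadic_shift (dyadic_interval n k) j|unit_leb. f y\<bar>)
          \<le> ennreal ((1 + K) / (1 - 2 powr (- (d / 2))) * w powr (P / p x))"
          by (rule ennreal_leI)
      qed
    qed
  qed
qed

text \<open>
  Half of the homogeneity of \<open>U_max\<close>, which is all that the passage from the modular to the norm needs.
\<close>

lemma U_max_scale_le:
  assumes "0 < l"
  shows "U_max s f x \<le> ennreal l * U_max s (\<lambda>y. f y / l) x"
  unfolding U_max_def
proof (rule SUP_least, clarify)
  fix n k assume k: "k < (2::nat) ^ n" "x \<in> dyadic_interval n k"
  let ?t = "\<lambda>f. (\<Sum>j<n. 2 powr ((real j - real n) * s)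
          * (1 / measure unit_leb (dyadic_shift (dyadic_interval n k) j))
          * \<bar>LINT y:dyadic_shift (dyadic_interval n k) j|unit_leb. f y\<bar>)"
  have "?t f = l * ?t (\<lambda>y. f y / l)"
    using assms by (simp add: sum_distrib_left)
  then have "ennreal (?t f) = ennreal l * ennreal (?t (\<lambda>y. f y / l))"
    using assms by (simp only: ennreal_mult'[OF less_imp_le])
  also have "\<dots> \<le> ennreal l * (SUP (n, k) \<in> {(n, k). k < 2 ^ n \<and> x \<in> dyadic_interval n k}.
        ennreal (\<Sum>j<n. 2 powr ((real j - real n) * s)
          * (1 / measure unit_leb (dyadic_shift (dyadic_interval n k) j))
          * \<bar>LINT y:dyadic_shift (dyadic_interval n k) j|unit_leb. f y / l\<bar>))"
    using k by (intro mult_left_mono SUP_upper2[of "(n, k)"]) auto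
  finally show "ennreal (?t f) \<le> \<dots>" .
qed

lemma ennreal_powr_mono:
  assumes "x \<le> y" "0 \<le> a"
  shows "ennreal_powr x a \<le> ennreal_powr y a"
proof (cases "y = \<infinity>")
  case True
  then show ?thesis by (simp add: ennreal_powr_def)
next
  case False
  then have y: "y < top" by (simp add: less_top)
  then have "x < top" using assms(1) by simp
  then show ?thesis
    using y assms unfolding ennreal_powr_def
    by (auto intro!: ennreal_leI powr_mono2 enn2real_mono)
qed

lemma ennreal_powr_ennreal: "0 \<le> y \<Longrightarrow> ennreal_powr (ennreal y) a = ennreal (y powr a)"
  by (simp add: ennreal_powr_def)

text \<open>
  The constant \<open>D\<close> is the bound of \<open>flip_max_strong_type\<close> when \<open>\<integral> g powr P \<le> 1\<close>; dividing by it
  normalises the modular.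
\<close>

lemma modular_U_max:
  fixes p f :: "real \<Rightarrow> real" and lo :: "nat \<Rightarrow> nat \<Rightarrow> real"
  assumes p [measurable]: "p \<in> borel_measurable unit_leb"
    and f [measurable]: "f \<in> borel_measurable unit_leb"
    and bounds: "AE x in unit_leb. \<forall>n. P \<le> lo n (dyadic_index n x) \<and> lo n (dyadic_index n x) \<le> p x
      \<and> p x \<le> Q \<and> 2 powr (real n * (p x - lo n (dyadic_index n x))) \<le> K"
    and P: "1 < P" and K: "1 \<le> K" and d: "d = s - (1 / P - 1 / Q)" "0 < d"
    and modular: "(\<integral>\<^sup>+x. ennreal (\<bar>f x\<bar> powr p x) \<partial>unit_leb) \<le> 1"
    and D: "D = 4 powr P * (1 + flip_const (d / 2) * (2 powr (P - 1) / (2 powr (P - 1) - 1)))"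
    and C: "C = (1 + K) / (1 - 2 powr (- (d / 2))) * D"
  shows "(\<integral>\<^sup>+x. ennreal_powr (U_max s f x / ennreal C) (p x) \<partial>unit_leb) \<le> 1"
proof -
  define g where "g = (\<lambda>x. (if 1 < \<bar>f x\<bar> then \<bar>f x\<bar> else 0) powr (p x / P))"
  have [measurable]: "g \<in> borel_measurable unit_leb"
    unfolding g_def by measurable
  have g0: "0 \<le> g x" for x by (simp add: g_def)
  define B where "B = flip_const (d / 2) * (2 powr (P - 1) / (2 powr (P - 1) - 1))"
  have "1 < 2 powr (P - 1)" using P by simp
  then have B: "0 \<le> B"
    unfolding B_def using flip_const_nonneg[of "d / 2"] d by (intro mult_nonneg_nonneg divide_nonneg_nonneg) auto
  have D_eq: "D = 4 powr P * (1 + B)" by (simp add: D B_def)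
  have "1 \<le> 4 powr P" using P by (intro ge_one_powr_ge_zero) auto
  then have "1 * 1 \<le> D" unfolding D_eq using B by (intro mult_mono) auto
  then have D1: "1 \<le> D" by simp
  define C' where "C' = (1 + K) / (1 - 2 powr (- (d / 2)))"
  have "2 powr (- (d / 2)) < 1" using d powr_less_mono[of "- (d / 2)" 0 2] by auto
  then have C': "0 < C'" using K by (simp add: C'_def)
  have CD: "C = C' * D" by (simp add: C C'_def)
  have "(\<integral>\<^sup>+x. ennreal (g x powr P) \<partial>unit_leb) \<le> (\<integral>\<^sup>+x. ennreal (\<bar>f x\<bar> powr p x) \<partial>unit_leb)"
    using P by (intro nn_integral_mono) (auto simp: g_def powr_powr)
  then have g1: "(\<integral>\<^sup>+x. ennreal (g x powr P) \<partial>unit_leb) \<le> 1"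
    using modular by (rule order_trans)
  have "AE x in unit_leb. ennreal_powr (U_max s f x / ennreal C) (p x)
    \<le> ennreal (1 / D) * ennreal_powr (max 1 (flip_max (d / 2) g x)) P"
    using U_max_le_flip_max[OF p f bounds P d modular g_def] bounds
  proof eventually_elim
    case (elim x)
    have px: "P \<le> p x" using elim(2)[rule_format, of 0] by auto
    show ?case
    proof (cases "flip_max (d / 2) g x")
      case top
      then show ?thesis
        using D1 by (simp add: ennreal_powr_def ennreal_mult_top)
    next
      case (real r)
      define w where "w = max 1 r"
      have w: "1 \<le> w" "flip_max (d / 2) g x \<le> ennreal w" "max 1 (flip_max (d / 2) g x) = ennreal w"
        using real by (auto simp: w_def max_def ennreal_leI)
      have "U_max s f x \<le> ennreal (C' * w powr (P / p x))"
        using elim(1) w unfolding C'_def by blast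
      then have "U_max s f x / ennreal C \<le> ennreal (C' * w powr (P / p x)) / ennreal C"
        by (rule divide_right_mono_ennreal)
      also have "\<dots> = ennreal (w powr (P / p x) / D)"
        using C' D1 by (subst divide_ennreal) (auto simp: CD)
      finally have "ennreal_powr (U_max s f x / ennreal C) (p x) \<le> ennreal_powr (ennreal (w powr (P / p x) / D)) (p x)"
        using P px by (intro ennreal_powr_mono) auto
      also have "\<dots> = ennreal ((w powr (P / p x) / D) powr p x)"
        using D1 by (intro ennreal_powr_ennreal) auto
      also have "(w powr (P / p x) / D) powr p x = w powr P / D powr p x"
        using P px D1 w by (simp add: powr_divide powr_powr)
      \<comment> \<open>Here \<open>D \<ge> 1\<close> and \<open>p x \<ge> 1\<close>.\<close>
      also have "w powr P / D powr p x \<le> w powr P / D powr 1"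
        using P px D1 by (intro divide_left_mono powr_mono) auto
      also have "\<dots> = 1 / D * w powr P" using D1 by simp
      also have "ennreal (1 / D * w powr P) = ennreal (1 / D) * ennreal (w powr P)"
        using D1 by (intro ennreal_mult) auto
      also have "ennreal (w powr P) = ennreal_powr (max 1 (flip_max (d / 2) g x)) P"
        using w by (simp add: ennreal_powr_ennreal)
      finally show ?thesis
        by (simp add: ennreal_leI)
    qed
  qed
  then have "(\<integral>\<^sup>+x. ennreal_powr (U_max s f x / ennreal C) (p x) \<partial>unit_leb)
    \<le> (\<integral>\<^sup>+x. ennreal (1 / D) * ennreal_powr (max 1 (flip_max (d / 2) g x)) P \<partial>unit_leb)"
    by (rule nn_integral_mono_AE)
  also have "\<dots> = ennreal (1 / D) * (\<integral>\<^sup>+x. ennreal_powr (max 1 (flip_max (d / 2) g x)) P \<partial>unit_leb)"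
    unfolding ennreal_powr_def by (rule nn_integral_cmult) measurable
  also have "\<dots> \<le> ennreal (1 / D) * (ennreal (4 powr P) * (1 + ennreal B * 1))"
    using d P g0 g1 unfolding B_def
    by (intro mult_left_mono order_trans[OF flip_max_strong_type] add_left_mono) auto
  also have "\<dots> = ennreal (1 / D * (4 powr P * (1 + B)))"
  proof -
    have "ennreal (1 / D * (4 powr P * (1 + B))) = ennreal (1 / D) * (ennreal (4 powr P) * ennreal (1 + B))"
      using B D1 by (simp only: ennreal_mult ennreal_mult' zero_le_divide_1_iff powr_ge_zero)
    then show ?thesis using B by simp
  qed
  also have "1 / D * (4 powr P * (1 + B)) = 1"
    using D1 by (simp add: D_eq[symmetric])
  finally show ?thesis by simp
qed

theorem theorem5p8:
  fixes p :: "real \<Rightarrow> real" and s K :: real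
  assumes "p \<in> borel_measurable unit_leb"
    and "\<And>x. x \<in> {0..<1} \<Longrightarrow> 0 < p x"
    and "1 < p_minus p {0..<1}"
    and "p_minus p {0..<1} \<le> p_plus p {0..<1}"
    and "p_plus p {0..<1} < \<infinity>"
    and "0 < s"
    and "1 \<le> K"
    and "\<And>n k. k < 2 ^ n \<Longrightarrow>
           measure unit_leb (dyadic_interval n k) powr
             real_of_ereal (p_minus p (dyadic_interval n k) - p_plus p (dyadic_interval n k)) \<le> K"
    and "1 / p_minus p {0..<1} - 1 / p_plus p {0..<1} < ereal s"
  shows "\<exists>C::real. 0 < C \<and>
           (\<forall>f \<in> Lvar p.
              Lvar_norm p (U_max s f) \<le> ennreal C * Lvar_norm p (\<lambda>x. ennreal \<bar>f x\<bar>))"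
proof -
  obtain P where P: "p_minus p {0..<1} = ereal P"
    using assms(3-5) by (cases "p_minus p {0..<1}") auto
  obtain Q where Q: "p_plus p {0..<1} = ereal Q"
    using assms(3-5) by (cases "p_plus p {0..<1}") auto
  have PQ: "1 < P" "P \<le> Q" using assms(3,4) P Q by auto
  define d where "d = s - (1 / P - 1 / Q)"
  have "1 / P - 1 / Q < s"
    using assms(9) PQ by (simp add: P Q one_ereal_def)
  then have d: "0 < d" by (simp add: d_def)
  define D where "D = 4 powr P * (1 + flip_const (d / 2) * (2 powr (P - 1) / (2 powr (P - 1) - 1)))"
  define C where "C = (1 + K) / (1 - 2 powr (- (d / 2))) * D"
  have C: "0 < C"
  proof -
    have "2 powr (- (d / 2)) < 1" using d powr_less_mono[of "- (d / 2)" 0 2] by auto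
    moreover have "1 < 2 powr (P - 1)" using PQ by simp
    moreover have "0 \<le> flip_const (d / 2)" using flip_const_nonneg d by simp
    ultimately show ?thesis
      unfolding C_def D_def using assms(7)
      by (intro mult_pos_pos divide_pos_pos add_pos_nonneg mult_nonneg_nonneg divide_nonneg_nonneg) auto
  qed
  note bounds = dyadic_exponent_bounds[OF assms(1) P Q assms(8)]
  have "Lvar_norm p (U_max s f) \<le> ennreal C * Lvar_norm p (\<lambda>x. ennreal \<bar>f x\<bar>)" if f: "f \<in> Lvar p" for f
  proof -
    have [measurable]: "f \<in> borel_measurable unit_leb" using f by (simp add: Lvar_def)
    have le: "Lvar_norm p (U_max s f) \<le> ennreal C * ennreal l"
      if l: "0 < l" "(\<integral>\<^sup>+ x. ennreal_powr (ennreal \<bar>f x\<bar> / ennreal l) (p x) \<partial>unit_leb) \<le> 1" for l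
    proof -
      have "(\<integral>\<^sup>+x. ennreal (\<bar>f x / l\<bar> powr p x) \<partial>unit_leb) \<le> 1"
        using l by (simp add: divide_ennreal ennreal_powr_ennreal)
      moreover have "(\<lambda>x. f x / l) \<in> borel_measurable unit_leb" by measurable
      ultimately have U1: "(\<integral>\<^sup>+x. ennreal_powr (U_max s (\<lambda>x. f x / l) x / ennreal C) (p x) \<partial>unit_leb) \<le> 1"
        by (intro modular_U_max[OF assms(1) _ bounds PQ(1) assms(7) d_def d _ D_def C_def])
      have "(\<integral>\<^sup>+x. ennreal_powr (U_max s f x / ennreal (C * l)) (p x) \<partial>unit_leb)
        \<le> (\<integral>\<^sup>+x. ennreal_powr (U_max s (\<lambda>x. f x / l) x / ennreal C) (p x) \<partial>unit_leb)"
      proof (intro nn_integral_mono ennreal_powr_mono)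
        fix x assume "x \<in> space unit_leb"
        then show "0 \<le> p x" using assms(2)[of x] by simp
        have "U_max s f x / ennreal (C * l) \<le> ennreal l * U_max s (\<lambda>x. f x / l) x / ennreal (C * l)"
          by (intro divide_right_mono_ennreal U_max_scale_le l)
        also have "\<dots> = U_max s (\<lambda>x. f x / l) x * ennreal l / (ennreal C * ennreal l)"
          using C l by (simp add: ennreal_mult mult.commute)
        also have "\<dots> = U_max s (\<lambda>x. f x / l) x / ennreal C"
          using l by (intro divide_mult_eq) auto
        finally show "U_max s f x / ennreal (C * l) \<le> U_max s (\<lambda>x. f x / l) x / ennreal C" .
      qed
      also note U1
      finally have "Lvar_norm p (U_max s f) \<le> ennreal (C * l)"
        unfolding Lvar_norm_def using C l by (intro INF_lower) auto
      then show ?thesis using C l by (simp add: ennreal_mult)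
    qed
    have "Lvar_norm p (U_max s f) / ennreal C \<le> Lvar_norm p (\<lambda>x. ennreal \<bar>f x\<bar>)"
      unfolding Lvar_norm_def[of p "\<lambda>x. ennreal \<bar>f x\<bar>"]
      using C le by (intro INF_greatest divide_le_posI_ennreal) auto
    then have "ennreal C * (Lvar_norm p (U_max s f) / ennreal C) \<le> ennreal C * Lvar_norm p (\<lambda>x. ennreal \<bar>f x\<bar>)"
      by (rule mult_left_mono) simp
    then show ?thesis
      using C by (simp add: ennreal_times_divide mult_divide_eq_ennreal mult.commute[of "ennreal C"])
  qed
  with C show ?thesis by blast
qed

end
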